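(* Let $q$ be a nonzero complex number and let $M$ be a $\mathfrak{B}(q)$-module such that $M$ is free of rank one as a $U(\mathbb{C}L_{0,0})$-module. Then there exist $\lambda\in\mathbb{C}^*$ and $\alpha,\beta\in\mathbb{C}$ such that, as $\mathfrak{B}(q)$-modules, $$M\cong\begin{cases}\Omega(\lambda,\alpha), & \text{if } q\neq -1,\\ \Omega(\lambda,\alpha,\beta), & \text{if } q=-1.\end{cases}$$ Moreover, with $M$ written in this form: if $q\neq-1$, then $M$ is simple if and only if $\alpha\neq0$; if $q=-1$, then $M$ is simple if and only if $\alpha\neq 0$ or $\beta\neq 0$.
   Context: All vector spaces and Lie algebras are over $\mathbb{C}$; $\mathbb{C}^*$ denotes the nonzero complex numbers, $\mathbb{Z}_+$ the nonnegative integers, $\mathbb{N}$ the positive integers, and $U(\mathfrak{g})$ the universal enveloping algebra of a Lie algebra $\mathfrak{g}$ (so $U(\mathbb{C}L_{0,0})=\mathbb{C}[L_{0,0}]$). For $q\in\mathbb{C}^*$, the Block type Lie algebra $\widehat{\mathfrak{B}(q)}$ has basis $\{L_{m,i}, C\mid (m,i)\in\mathbb{Z}\times\mathbb{Z}_+\}$ and relations $$[L_{m,i},L_{n,j}]=\big(n(i+q)-m(j+q)\big)L_{m+n,i+j}+\delta_{m+n,0}\delta_{i+j,0}\frac{m^3-m}{12}C,\qquad [C,L_{m,i}]=0.$$ Set $\mathfrak{B}(q):=[\widehat{\mathfrak{B}(q)},\widehat{\mathfrak{B}(q)}]$. It has basis consisting of $C$ and all $L_{m,i}$ with $(m,i)\in\mathbb{Z}\times\mathbb{Z}_+$,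 except that when $-2q\in\mathbb{N}$ the index $(m,i)=(0,-2q)$ is omitted. For $\lambda\in\mathbb{C}^*$, $\alpha,\beta\in\mathbb{C}$, the $\mathfrak{B}(q)$-modules $\Omega(\lambda,\alpha)$ (for $q\neq-1$) and $\Omega(\lambda,\alpha,\beta)$ (for $q=-1$) both have underlying space $\mathbb{C}[t]$ with action $$L_{m,i}\cdot f(t)=\lambda^m\big(\delta_{i,0}(t-mq\alpha)+\delta_{q,-1}\delta_{i,1}\beta\big)f(t-mq),\qquad C\cdot f(t)=0,$$ for $f(t)\in\mathbb{C}[t]$ and all $(m,i)$ indexing basis elements $L_{m,i}$ of $\mathfrak{B}(q)$. (In particular, for $q\ne -1$ the parameter $\beta$ does not occur.) *)

theory Defs
  imports Complex_Main "HOL-Library.Poly_Mapping" "HOL-Computational_Algebra.Polynomial"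
begin

locale lie_algebra = vector_space scale
  for scale :: "complex \<Rightarrow> 'g::ab_group_add \<Rightarrow> 'g" +
  fixes bracket :: "'g \<Rightarrow> 'g \<Rightarrow> 'g"
  assumes linear_bracket_left: "Vector_Spaces.linear scale scale (\<lambda>x. bracket x y)"
    and linear_bracket_right: "Vector_Spaces.linear scale scale (bracket x)"
    and bracket_self: "bracket x x = 0"
    and jacobi: "bracket x (bracket y z) + bracket y (bracket z x) + bracket z (bracket x y) = 0"
begin

definition subalgebra :: "'g set \<Rightarrow> bool" where
  "subalgebra \<gg> \<longleftrightarrow> subspace \<gg> \<and> (\<forall>x\<in>\<gg>. \<forall>y\<in>\<gg>. bracket x y \<in> \<gg>)"

definition derived_algebra :: "'g set" where
  "derived_algebra = span {bracket x y | x y. True}"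

lemma subalgebra_derived_algebra: "subalgebra derived_algebra"
  unfolding subalgebra_def derived_algebra_def by (auto intro: span_base)

end

text \<open>A module over a Lie subalgebra \<open>\<gg>\<close>: the values of \<open>act\<close> outside of \<open>\<gg>\<close> are irrelevant.\<close>

locale lie_module = lie_algebra scaleG bracket + V: vector_space scaleV
  for scaleG :: "complex \<Rightarrow> 'g::ab_group_add \<Rightarrow> 'g"
    and bracket :: "'g \<Rightarrow> 'g \<Rightarrow> 'g"
    and \<gg> :: "'g set"
    and scaleV :: "complex \<Rightarrow> 'v::ab_group_add \<Rightarrow> 'v"
    and act :: "'g \<Rightarrow> 'v \<Rightarrow> 'v" +
  assumes subalgebra: "subalgebra \<gg>"
    and act_linear: "x \<in> \<gg> \<Longrightarrow> Vector_Spaces.linear scaleV scaleV (act x)"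
    and act_add: "x \<in> \<gg> \<Longrightarrow> y \<in> \<gg> \<Longrightarrow> act (x + y) v = act x v + act y v"
    and act_scale: "x \<in> \<gg> \<Longrightarrow> act (scaleG c x) v = scaleV c (act x v)"
    and act_bracket: "x \<in> \<gg> \<Longrightarrow> y \<in> \<gg> \<Longrightarrow>
      act (bracket x y) v = act x (act y v) - act y (act x v)"

definition submodule ::
  "'g set \<Rightarrow> (complex \<Rightarrow> 'v::ab_group_add \<Rightarrow> 'v) \<Rightarrow> ('g \<Rightarrow> 'v \<Rightarrow> 'v) \<Rightarrow> 'v set \<Rightarrow> bool" where
  "submodule \<gg> scaleV act N \<longleftrightarrow> module.subspace scaleV N \<and> (\<forall>x\<in>\<gg>. \<forall>v\<in>N. act x v \<in> N)"

definition simple_module ::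
  "'g set \<Rightarrow> (complex \<Rightarrow> 'v::ab_group_add \<Rightarrow> 'v) \<Rightarrow> ('g \<Rightarrow> 'v \<Rightarrow> 'v) \<Rightarrow> bool" where
  "simple_module \<gg> scaleV act \<longleftrightarrow>
     (UNIV :: 'v set) \<noteq> {0} \<and> (\<forall>N. submodule \<gg> scaleV act N \<longrightarrow> N = {0} \<or> N = UNIV)"

definition isomorphic_modules ::
  "'g set \<Rightarrow> (complex \<Rightarrow> 'v::ab_group_add \<Rightarrow> 'v) \<Rightarrow> ('g \<Rightarrow> 'v \<Rightarrow> 'v) \<Rightarrow>
   (complex \<Rightarrow> 'w::ab_group_add \<Rightarrow> 'w) \<Rightarrow> ('g \<Rightarrow> 'w \<Rightarrow> 'w) \<Rightarrow> bool" where
  "isomorphic_modules \<gg> scaleV actV scaleW actW \<longleftrightarrow>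
     (\<exists>f. Vector_Spaces.linear scaleV scaleW f \<and> bij f \<and>
          (\<forall>x\<in>\<gg>. \<forall>v. f (actV x v) = actW x (f v)))"

text \<open>
  For a one-dimensional Lie algebra \<open>\<complex>x\<close> the enveloping algebra \<open>U(\<complex>x)\<close> is the
  polynomial ring \<open>\<complex>[x]\<close>, modelled by \<^typ>\<open>complex poly\<close>; \<open>T\<close> is the operator by which
  \<open>x\<close> acts.
\<close>

definition poly_act ::
  "(complex \<Rightarrow> 'v::ab_group_add \<Rightarrow> 'v) \<Rightarrow> ('v \<Rightarrow> 'v) \<Rightarrow> complex poly \<Rightarrow> 'v \<Rightarrow> 'v" where
  "poly_act scaleV T p v = (\<Sum>i\<le>degree p. scaleV (coeff p i) ((T ^^ i) v))"

definition free_of_rank :: "nat \<Rightarrow> ('r::comm_ring_1 \<Rightarrow> 'v::ab_group_add \<Rightarrow> 'v) \<Rightarrow> bool" where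
  "free_of_rank n scl \<longleftrightarrow>
     (\<exists>B. finite B \<and> card B = n \<and> \<not> module.dependent scl B \<and> module.span scl B = UNIV)"

lemma poly_act_alt:
  assumes "module scaleV" "degree p \<le> n"
  shows "poly_act scaleV T p v = (\<Sum>i\<le>n. scaleV (coeff p i) ((T ^^ i) v))"
proof -
  interpret module scaleV by fact
  show ?thesis
    unfolding poly_act_def using assms(2)
    by (intro sum.mono_neutral_left) (auto simp: coeff_eq_0 not_le)
qed

lemma module_poly_act:
  assumes lin: "Vector_Spaces.linear scaleV scaleV T"
  shows "module (poly_act scaleV T)"
proof -
  interpret T: Vector_Spaces.linear scaleV scaleV T by fact
  have m: "module scaleV" ..
  have pow_add: "(T ^^ i) (v + w) = (T ^^ i) v + (T ^^ i) w" for i v w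
    by (induction i) (auto simp: T.add)
  have lin_p: "poly_act scaleV T p (v + w) = poly_act scaleV T p v + poly_act scaleV T p w" for p v w
    by (simp add: poly_act_def pow_add T.vs1.scale_right_distrib sum.distrib)
  have add_p: "poly_act scaleV T (p + r) v = poly_act scaleV T p v + poly_act scaleV T r v" for p r v
    using degree_add_le_max[of p r]
    by (simp add: poly_act_alt[OF m, of _ "max (degree p) (degree r)"]
        T.vs1.scale_left_distrib sum.distrib)
  have T_p: "poly_act scaleV T p (T v) = T (poly_act scaleV T p v)" for p v
    by (simp add: poly_act_def T.sum T.scale funpow_swap1)
  have smult_p: "poly_act scaleV T (smult c p) v = scaleV c (poly_act scaleV T p v)" for c p v
    using degree_smult_le[of c p]
    by (simp add: poly_act_alt[OF m, of _ "degree p"] T.vs1.scale_sum_right)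
  have pCons_p: "poly_act scaleV T (pCons c p) v = scaleV c v + poly_act scaleV T p (T v)" for c p v
  proof -
    have "poly_act scaleV T (pCons c p) v
        = (\<Sum>i\<le>Suc (degree p). scaleV (coeff (pCons c p) i) ((T ^^ i) v))"
      using degree_pCons_le by (intro poly_act_alt[OF m])
    also have "\<dots> = scaleV c v + poly_act scaleV T p (T v)"
      by (subst sum.atMost_Suc_shift) (simp add: poly_act_def funpow_swap1)
    finally show ?thesis .
  qed
  have mult_p: "poly_act scaleV T p (poly_act scaleV T r v) = poly_act scaleV T (p * r) v" for p r v
  proof (induction p arbitrary: v)
    case 0
    then show ?case by (simp add: poly_act_def)
  next
    case (pCons c p)
    have "poly_act scaleV T (pCons 0 (p * r)) v = poly_act scaleV T (p * r) (T v)"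
      by (simp add: pCons_p)
    then show ?case
      by (simp add: pCons_p T_p[symmetric] pCons.IH add_p smult_p)
  qed
  show ?thesis
    by unfold_locales (auto simp: lin_p add_p mult_p, simp add: poly_act_def)
qed

definition lin_ext ::
  "(complex \<Rightarrow> 'v::comm_monoid_add \<Rightarrow> 'v) \<Rightarrow> ('k \<Rightarrow> 'v) \<Rightarrow> ('k \<Rightarrow>\<^sub>0 complex) \<Rightarrow> 'v" where
  "lin_ext scaleV g x = (\<Sum>k\<in>Poly_Mapping.keys x. scaleV (Poly_Mapping.lookup x k) (g k))"

definition pm_scale :: "complex \<Rightarrow> ('k \<Rightarrow>\<^sub>0 complex) \<Rightarrow> ('k \<Rightarrow>\<^sub>0 complex)" where
  "pm_scale c = Poly_Mapping.map ((*) c)"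

lemma lookup_pm_scale [simp]: "Poly_Mapping.lookup (pm_scale c x) k = c * Poly_Mapping.lookup x k"
  by (simp add: pm_scale_def map.rep_eq when_def)

lemma vector_space_pm_scale: "vector_space pm_scale"
  by unfold_locales (auto intro!: poly_mapping_eqI simp: lookup_add algebra_simps)

lemma lin_ext_superset:
  assumes "module scaleV" "finite A" "Poly_Mapping.keys x \<subseteq> A"
  shows "lin_ext scaleV g x = (\<Sum>k\<in>A. scaleV (Poly_Mapping.lookup x k) (g k))"
proof -
  interpret module scaleV by fact
  show ?thesis
    unfolding lin_ext_def using assms(2,3)
    by (intro sum.mono_neutral_left) (auto simp: in_keys_iff)
qed

lemma lin_ext_add:
  assumes "module scaleV"
  shows "lin_ext scaleV g (x + y) = lin_ext scaleV g x + lin_ext scaleV g y"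
proof -
  interpret module scaleV by fact
  have "Poly_Mapping.keys (x + y) \<subseteq> Poly_Mapping.keys x \<union> Poly_Mapping.keys y"
    by (rule Poly_Mapping.keys_add)
  then show ?thesis
    by (simp add: lin_ext_superset[OF assms, of "Poly_Mapping.keys x \<union> Poly_Mapping.keys y"] lookup_add
        scale_left_distrib sum.distrib)
qed

lemma lin_ext_scale:
  assumes "module scaleV"
  shows "lin_ext scaleV g (pm_scale c x) = scaleV c (lin_ext scaleV g x)"
proof -
  interpret module scaleV by fact
  have "Poly_Mapping.keys (pm_scale c x) \<subseteq> Poly_Mapping.keys x"
    by (auto simp: in_keys_iff)
  then show ?thesis
    by (simp add: lin_ext_superset[OF assms, of "Poly_Mapping.keys x"] scale_sum_right)
qed

lemma lin_ext_single [simp]: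
  assumes "module scaleV"
  shows "lin_ext scaleV g (Poly_Mapping.single k c) = scaleV c (g k)"
proof -
  interpret module scaleV by fact
  show ?thesis by (simp add: lin_ext_def)
qed

datatype block_basis = L int nat | C

type_synonym block = "block_basis \<Rightarrow>\<^sub>0 complex"

fun block_bracket_basis :: "complex \<Rightarrow> block_basis \<Rightarrow> block_basis \<Rightarrow> block" where
  "block_bracket_basis q (L m i) (L n j) =
     Poly_Mapping.single (L (m + n) (i + j))
       (of_int n * (of_nat i + q) - of_int m * (of_nat j + q)) +
     Poly_Mapping.single C
       (if m + n = 0 \<and> i + j = 0 then (of_int m ^ 3 - of_int m) / 12 else 0)"
| "block_bracket_basis q C _ = 0"
| "block_bracket_basis q _ C = 0"

definition block_bracket :: "complex \<Rightarrow> block \<Rightarrow> block \<Rightarrow> block" where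
  "block_bracket q x y =
     lin_ext pm_scale (\<lambda>a. lin_ext pm_scale (block_bracket_basis q a) y) x"

lemma pm_induct [case_names single add]:
  assumes single: "\<And>k c. P (Poly_Mapping.single k c)"
    and add: "\<And>x y. P x \<Longrightarrow> P y \<Longrightarrow> P (x + y)"
  shows "P x"
proof (induction x rule: update_induct)
  case const
  show ?case using single[of undefined 0] by simp
next
  case (update f a b)
  have "Poly_Mapping.update a b f = f + Poly_Mapping.single a b"
    using update(1)
    by (auto intro!: poly_mapping_eqI simp: lookup_update lookup_add lookup_single in_keys_iff when_def)
  then show ?case using update(3) single add by simp
qed

lemma pm_scale_single [simp]:
  "pm_scale c (Poly_Mapping.single k d) = Poly_Mapping.single k (c * d)"
  by (auto intro!: poly_mapping_eqI simp: lookup_single when_def)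

lemma module_pm_scale: "module pm_scale"
  using vector_space_pm_scale by (simp add: module_iff_vector_space)

lemma block_bracket_add:
  "block_bracket q (x + y) z = block_bracket q x z + block_bracket q y z"
  "block_bracket q z (x + y) = block_bracket q z x + block_bracket q z y"
  unfolding block_bracket_def
  by (simp_all add: lin_ext_add[OF module_pm_scale])
     (simp add: lin_ext_def poly_mapping_eq_iff fun_eq_iff lookup_sum lookup_add
       sum.distrib distrib_left)

lemma block_bracket_scale:
  "block_bracket q (pm_scale c x) z = pm_scale c (block_bracket q x z)"
  "block_bracket q z (pm_scale c x) = pm_scale c (block_bracket q z x)"
  unfolding block_bracket_def
  by (simp_all add: lin_ext_scale[OF module_pm_scale])
     (simp add: lin_ext_def poly_mapping_eq_iff fun_eq_iff lookup_sum
       sum_distrib_left mult_ac)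

lemma block_bracket_zero [simp]: "block_bracket q x 0 = 0"
  using block_bracket_add(2)[of q x 0 0] by simp

lemma block_bracket_single:
  "block_bracket q (Poly_Mapping.single a c) (Poly_Mapping.single b d) =
     pm_scale (c * d) (block_bracket_basis q a b)"
  by (simp add: block_bracket_def module_pm_scale poly_mapping_eq_iff fun_eq_iff)

lemma block_bracket_LL:
  "block_bracket q (Poly_Mapping.single (L m i) c) (Poly_Mapping.single (L n j) d) =
     Poly_Mapping.single (L (m + n) (i + j))
       (c * d * (of_int n * (of_nat i + q) - of_int m * (of_nat j + q))) +
     Poly_Mapping.single C
       (c * d * (if m + n = 0 \<and> i + j = 0 then (of_int m ^ 3 - of_int m) / 12 else 0))"
  by (simp add: block_bracket_single poly_mapping_eq_iff fun_eq_iff lookup_add lookup_single when_def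
      del: of_int_mult)

lemma block_bracket_C:
  "block_bracket q (Poly_Mapping.single C c) x = 0"
  "block_bracket q x (Poly_Mapping.single C c) = 0"
proof -
  have [simp]: "block_bracket_basis q a C = 0" for a
    by (cases a) auto
  have [simp]: "pm_scale c (0 :: block) = 0" for c
    by (simp add: poly_mapping_eq_iff fun_eq_iff)
  show "block_bracket q (Poly_Mapping.single C c) x = 0"
    by (induction x rule: pm_induct) (simp_all add: block_bracket_add block_bracket_single)
  show "block_bracket q x (Poly_Mapping.single C c) = 0"
    by (induction x rule: pm_induct) (simp_all add: block_bracket_add block_bracket_single)
qed

lemma block_bracket_antisym: "block_bracket q x y + block_bracket q y x = 0"
proof (induction x rule: pm_induct)
  case x: (single a c)
  show ?case
  proof (induction y rule: pm_induct)
    case y: (single b d)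
    show ?case
    proof (cases a; cases b)
      fix m i n j assume [simp]: "a = L m i" "b = L n j"
      have *: "(if m + n = 0 \<and> i + j = 0 then (of_int m ^ 3 - of_int m) / 12 else 0)
          + (if n + m = 0 \<and> j + i = 0 then (of_int n ^ 3 - of_int n) / 12 else (0::complex)) = 0"
        by (auto simp: add_eq_0_iff field_simps)
      have "block_bracket q (Poly_Mapping.single a c) (Poly_Mapping.single b d)
          + block_bracket q (Poly_Mapping.single b d) (Poly_Mapping.single a c)
        = Poly_Mapping.single C (c * d * 
          ((if m + n = 0 \<and> i + j = 0 then (of_int m ^ 3 - of_int m) / 12 else 0)
          + (if n + m = 0 \<and> j + i = 0 then (of_int n ^ 3 - of_int n) / 12 else 0)))"
        by (auto simp: block_bracket_LL poly_mapping_eq_iff fun_eq_iff lookup_add lookup_single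
            when_def add.commute algebra_simps)
      then show ?thesis by (simp only: * mult_zero_right single_zero)
    qed (simp_all add: block_bracket_C)
  next
    case (add y z)
    then show ?case by (simp add: block_bracket_add algebra_simps)
  qed
next
  case (add x z)
  then show ?case by (simp add: block_bracket_add algebra_simps)
qed

lemma block_bracket_LLL:
  "block_bracket q (Poly_Mapping.single (L m i) c) (block_bracket q
     (Poly_Mapping.single (L n j) d) (Poly_Mapping.single (L k l) e)) =
   Poly_Mapping.single (L (m + n + k) (i + j + l))
     (c * d * e * ((of_int n * (of_nat i + q) + of_int k * (of_nat i + q)
         - of_int m * (of_nat j + of_nat l + q))
       * (of_int k * (of_nat j + q) - of_int n * (of_nat l + q)))) +
   Poly_Mapping.single C
     (if m + n + k = 0 \<and> i = 0 \<and> j = 0 \<and> l = 0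
      then c * d * e * (q * (of_int k - of_int n) * (of_int m ^ 3 - of_int m) / 12) else 0)"
  unfolding block_bracket_LL[of _ n] block_bracket_add block_bracket_C block_bracket_LL
  by (auto simp: algebra_simps add_divide_distrib diff_divide_distrib)

lemma add_zero_add:
  assumes "a + b + c = 0" "a' + b' + c' = 0"
  shows "(a + a') + (b + b') + (c + c') = (0 :: block)"
proof -
  have "(a + a') + (b + b') + (c + c') = (a + b + c) + (a' + b' + c')"
    by (simp only: ac_simps)
  then show ?thesis using assms by simp
qed

lemma block_jacobi:
  "block_bracket q x (block_bracket q y z) + block_bracket q y (block_bracket q z x)
     + block_bracket q z (block_bracket q x y) = 0"
proof (induction x rule: pm_induct)
  case x: (single a c)
  show ?case
  proof (induction y rule: pm_induct)
    case y: (single b d)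
    show ?case
    proof (induction z rule: pm_induct)
      case z: (single e f)
      show ?case
      proof (cases a; cases b; cases e)
        fix m i n j k l assume [simp]: "a = L m i" "b = L n j" "e = L k l"
        define M where "M = m + n + k"
        define I where "I = i + j + l"
        have MI: "m + n + k = M" "n + k + m = M" "k + m + n = M"
          "i + j + l = I" "j + l + i = I" "l + i + j = I"
          by (simp_all add: M_def I_def)
        have swap: "(s + t) + (s' + t') + (s'' + t'') = (s + s' + s'') + (t + t' + t'')"
          for s t s' t' s'' t'' :: block
          by (simp add: algebra_simps)
        show ?thesis
          unfolding \<open>a = _\<close> \<open>b = _\<close> \<open>e = _\<close> block_bracket_LLL swap
        proof (simp only: MI single_add[symmetric], goal_cases)
          case 1
          have 1: "Poly_Mapping.single x s + Poly_Mapping.single y t = (0 :: block)"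
            if "s = 0" "t = 0" for x y s t
            using that by simp
          show ?case
          proof (rule 1, goal_cases)
            case 1
            show ?case by (simp add: algebra_simps)
          next
            case 2
            show ?case
            proof (cases "M = 0 \<and> i = 0 \<and> j = 0 \<and> l = 0")
              case True
              then have k: "k = - m - n" by (simp add: M_def)
              show ?thesis
                unfolding k using True
                by (simp add: add_divide_distrib[symmetric])
                  (simp add: algebra_simps power3_eq_cube)
            next
              case False
              then show ?thesis by auto
            qed
          qed
        qed
      qed (simp_all add: block_bracket_C block_bracket_add block_bracket_LL)
    next
      case (add y z)
      show ?case unfolding block_bracket_add by (rule add_zero_add[OF add])
    qed
  next
    case (add y z)
    show ?case unfolding block_bracket_add by (rule add_zero_add[OF add])
  qed
next
  case (add x z)
  show ?case unfolding block_bracket_add by (rule add_zero_add[OF add])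
qed

interpretation block: lie_algebra pm_scale "block_bracket q" for q
proof -
  interpret vector_space "pm_scale :: complex \<Rightarrow> block \<Rightarrow> block"
    by (rule vector_space_pm_scale)
  have "block_bracket q x x = 0" for x
  proof -
    have "pm_scale 2 (block_bracket q x x) = block_bracket q x x + block_bracket q x x"
      by (simp add: poly_mapping_eq_iff fun_eq_iff lookup_add)
    then show ?thesis
      by (simp add: block_bracket_antisym)
  qed
  then show "lie_algebra pm_scale (block_bracket q)"
    by unfold_locales (auto simp: block_bracket_add block_bracket_scale block_jacobi)
qed

definition block_algebra :: "complex \<Rightarrow> block set" where
  "block_algebra q = lie_algebra.derived_algebra pm_scale (block_bracket q)"

lemma block_algebra_eq:
  assumes "q \<noteq> 0"
  shows "block_algebra q = {x. \<forall>i. of_nat i = - 2 * q \<longrightarrow> Poly_Mapping.lookup x (L 0 i) = 0}"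
    (is "_ = ?S")
proof (rule antisym)
  have sub: "block.subspace ?S"
    by (rule block.subspaceI) (auto simp: lookup_add)
  have "block_bracket q x y \<in> ?S" for x y
  proof (induction x rule: pm_induct)
    case x: (single a c)
    show ?case
    proof (induction y rule: pm_induct)
      case y: (single b d)
      show ?case
      proof (cases a; cases b)
        fix m i n j assume [simp]: "a = L m i" "b = L n j"
        have "of_int n * (of_nat i + q) - of_int m * (of_nat j + q) = 0"
          if "m + n = 0" "of_nat i + of_nat j = - 2 * q"
        proof -
          have m: "m = - n" using that(1) by simp
          have j: "of_nat j = - 2 * q - of_nat i"
            using that(2) by (metis add_diff_cancel_left')
          show ?thesis unfolding m j by (simp add: algebra_simps)
        qed
        then have "of_int n * (of_nat i + q) - of_int m * (of_nat j + q) = 0"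
          if "m + n = 0" "i + j = k" "of_nat k = - 2 * q" for k
          using that by (metis of_nat_add)
        then have "Poly_Mapping.lookup (Poly_Mapping.single (L (m + n) (i + j))
            (c * d * (of_int n * (of_nat i + q) - of_int m * (of_nat j + q)))) (L 0 k) = 0"
          if "of_nat k = - 2 * q" for k
          using that by (cases "m + n = 0 \<and> i + j = k") (auto simp only: lookup_single when_def
              block_basis.inject if_False if_cancel mult_zero_right)
        then show ?thesis
          by (simp add: block_bracket_LL lookup_add lookup_single_not_eq del: of_int_mult)
      qed (simp_all add: block_bracket_C)
    next
      case (add y z)
      then show ?case unfolding block_bracket_add by (rule block.subspace_add[OF sub])
    qed
  next
    case (add x z)
    then show ?case unfolding block_bracket_add by (rule block.subspace_add[OF sub])
  qed
  then show "block_algebra q \<subseteq> ?S"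
    unfolding block_algebra_def block.derived_algebra_def
    by (intro block.span_minimal sub) auto
next
  have sub: "block.subspace (block_algebra q)"
    unfolding block_algebra_def block.derived_algebra_def by (rule block.subspace_span)
  have br: "block_bracket q x y \<in> block_algebra q" for x y
    unfolding block_algebra_def block.derived_algebra_def by (intro block.span_base) auto
  have scl: "Poly_Mapping.single k d \<in> block_algebra q"
    if "Poly_Mapping.single k c \<in> block_algebra q" "c \<noteq> 0" for k c d
    using block.subspace_scale[OF sub that(1), of "d / c"] that(2) by simp
  have L1: "Poly_Mapping.single (L m i) c \<in> block_algebra q" if "m \<noteq> 0" for m i c
  proof (rule scl)
    have "block_bracket q (Poly_Mapping.single (L 0 0) 1) (Poly_Mapping.single (L m i) 1)
        = Poly_Mapping.single (L m i) (of_int m * q)"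
      by (simp add: block_bracket_LL)
    then show "Poly_Mapping.single (L m i) (of_int m * q) \<in> block_algebra q"
      using br by metis
    show "of_int m * q \<noteq> 0"
      using that assms by simp
  qed
  have L2: "Poly_Mapping.single (L 0 i) c \<in> block_algebra q" if "of_nat i \<noteq> - 2 * q" for i c
  proof (rule scl)
    have "block_bracket q (Poly_Mapping.single (L 1 0) 1) (Poly_Mapping.single (L (- 1) i) 1)
        = Poly_Mapping.single (L 0 i) (- q - (of_nat i + q))"
      by (simp add: block_bracket_LL)
    then show "Poly_Mapping.single (L 0 i) (- q - (of_nat i + q)) \<in> block_algebra q"
      using br by metis
    show "- q - (of_nat i + q) \<noteq> 0"
    proof
      assume "- q - (of_nat i + q) = 0"
      then have "of_nat i = of_nat i + (- q - (of_nat i + q))" by simp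
      also have "\<dots> = - 2 * q" by simp
      finally show False using that by contradiction
    qed
  qed
  have CC: "Poly_Mapping.single C c \<in> block_algebra q" for c
  proof -
    have "block_bracket q (Poly_Mapping.single (L 2 0) 1) (Poly_Mapping.single (L (- 2) 0) 1)
        = Poly_Mapping.single (L 0 0) (- 2 * q - 2 * q) + Poly_Mapping.single C (1 / 2)"
      by (simp add: block_bracket_LL)
    then have "Poly_Mapping.single (L 0 0) (- 2 * q - 2 * q) + Poly_Mapping.single C (1 / 2) \<in> block_algebra q"
      using br by metis
    moreover have "Poly_Mapping.single (L 0 0) (- 2 * q - 2 * q) \<in> block_algebra q"
      using assms by (intro L2) simp
    ultimately have "Poly_Mapping.single C (1 / 2) \<in> block_algebra q"
      using block.subspace_diff[OF sub] by (metis add_diff_cancel_left')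
    then show ?thesis by (rule scl) auto
  qed
  show "?S \<subseteq> block_algebra q"
  proof
    fix x assume x: "x \<in> ?S"
    have "x = (\<Sum>k\<in>Poly_Mapping.keys x. Poly_Mapping.single k (Poly_Mapping.lookup x k))"
      by (rule poly_mapping_eqI) (simp add: lookup_sum lookup_single when_def in_keys_iff)
    also have "\<dots> \<in> block_algebra q"
    proof (rule block.subspace_sum[OF sub])
      fix k assume k: "k \<in> Poly_Mapping.keys x"
      show "Poly_Mapping.single k (Poly_Mapping.lookup x k) \<in> block_algebra q"
      proof (cases k)
        case (L m i)
        then show ?thesis
          using x k L1[of m] L2[of i] by (cases "m = 0") (auto simp: in_keys_iff simp del: mult_minus_left)
      qed (simp add: CC)
    qed
    finally show "x \<in> block_algebra q" .
  qed
qed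

text \<open>
  \<open>omega q lam \<alpha> \<beta>\<close> is \<open>\<Omega>(lam,\<alpha>)\<close> for \<open>q \<noteq> -1\<close>, where \<open>\<beta>\<close> does not occur, and
  \<open>\<Omega>(lam,\<alpha>,\<beta>)\<close> for \<open>q = -1\<close>. It is only meant to be used on \<^term>\<open>block_algebra q\<close>.
\<close>

fun omega_basis ::
  "complex \<Rightarrow> complex \<Rightarrow> complex \<Rightarrow> complex \<Rightarrow> block_basis \<Rightarrow> complex poly \<Rightarrow> complex poly" where
  "omega_basis q lam \<alpha> \<beta> (L m i) f =
     smult (lam powi m)
       (((if i = 0 then [:- (of_int m * q * \<alpha>), 1:] else 0) +
         (if q = - 1 \<and> i = 1 then [:\<beta>:] else 0)) *
        pcompose f [:- (of_int m * q), 1:])"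
| "omega_basis q lam \<alpha> \<beta> C f = 0"

definition omega ::
  "complex \<Rightarrow> complex \<Rightarrow> complex \<Rightarrow> complex \<Rightarrow> block \<Rightarrow> complex poly \<Rightarrow> complex poly" where
  "omega q lam \<alpha> \<beta> x f = lin_ext smult (\<lambda>b. omega_basis q lam \<alpha> \<beta> b f) x"

lemma omega_basis_linear:
  "omega_basis q lam \<alpha> \<beta> b (f + g) = omega_basis q lam \<alpha> \<beta> b f + omega_basis q lam \<alpha> \<beta> b g"
  "omega_basis q lam \<alpha> \<beta> b (smult c f) = smult c (omega_basis q lam \<alpha> \<beta> b f)"
  by (cases b; simp add: pcompose_add pcompose_smult distrib_left smult_add_right mult.commute)+

lemma module_smult: "module (smult :: complex \<Rightarrow> complex poly \<Rightarrow> complex poly)"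
  by unfold_locales (auto simp: smult_add_left smult_add_right)

lemma omega_left:
  "omega q lam \<alpha> \<beta> (x + y) f = omega q lam \<alpha> \<beta> x f + omega q lam \<alpha> \<beta> y f"
  "omega q lam \<alpha> \<beta> (pm_scale c x) f = smult c (omega q lam \<alpha> \<beta> x f)"
  "omega q lam \<alpha> \<beta> (Poly_Mapping.single b c) f = smult c (omega_basis q lam \<alpha> \<beta> b f)"
  "omega q lam \<alpha> \<beta> 0 f = 0"
  by (simp_all add: omega_def lin_ext_add lin_ext_scale module_smult) (simp add: lin_ext_def)

lemma omega_right:
  "omega q lam \<alpha> \<beta> x (f + g) = omega q lam \<alpha> \<beta> x f + omega q lam \<alpha> \<beta> x g"
  "omega q lam \<alpha> \<beta> x (smult c f) = smult c (omega q lam \<alpha> \<beta> x f)"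
  by (induction x rule: pm_induct)
     (simp_all add: omega_left omega_basis_linear smult_add_right algebra_simps)

lemma poly_omega_basis:
  "poly (omega_basis q lam \<alpha> \<beta> (L m i) f) t =
     lam powi m * ((if i = 0 then t - of_int m * q * \<alpha> else 0) + (if q = - 1 \<and> i = 1 then \<beta> else 0))
       * poly f (t - of_int m * q)"
proof -
  have "poly [:- (of_int m * q), 1:] t = t - of_int m * q" by simp
  then show ?thesis by (simp add: poly_pcompose del: poly_pCons) auto
qed

lemma omega_bracket:
  assumes "lam \<noteq> 0"
  shows "omega q lam \<alpha> \<beta> (block_bracket q x y) f =
    omega q lam \<alpha> \<beta> x (omega q lam \<alpha> \<beta> y f) - omega q lam \<alpha> \<beta> y (omega q lam \<alpha> \<beta> x f)"
proof (induction x rule: pm_induct)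
  case x: (single a c)
  show ?case
  proof (induction y rule: pm_induct)
    case y: (single b d)
    show ?case
    proof (cases a; cases b)
      fix m i n j assume [simp]: "a = L m i" "b = L n j"
      define K where "K m i t = (if i = 0 then t - of_int m * q * \<alpha> else 0)
        + (if q = - 1 \<and> i = 1 then \<beta> else 0)" for m :: int and i :: nat and t
      have K: "(of_int n * (of_nat i + q) - of_int m * (of_nat j + q)) * K (m + n) (i + j) t
        = K m i t * K n j (t - of_int m * q) - K n j t * K m i (t - of_int n * q)" for t
        by (cases "i = 0"; cases "i = 1"; cases "j = 0"; cases "j = 1"; cases "q = - 1")
           (auto simp: K_def algebra_simps)
      have P: "poly (omega_basis q lam \<alpha> \<beta> (L m i) f) t =
        lam powi m * K m i t * poly f (t - of_int m * q)" for m i f t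
        by (simp only: poly_omega_basis K_def)
      have pw: "lam powi (m + n) = lam powi m * lam powi n"
        using assms by (simp add: power_int_add)
      have shift: "t - of_int n * q - of_int m * q = t - of_int (m + n) * q"
        "t - of_int m * q - of_int n * q = t - of_int (m + n) * q" for t
        by (simp_all add: algebra_simps)
      have "poly (omega q lam \<alpha> \<beta> (block_bracket q (Poly_Mapping.single a c) (Poly_Mapping.single b d)) f) t =
        poly (omega q lam \<alpha> \<beta> (Poly_Mapping.single a c) (omega q lam \<alpha> \<beta> (Poly_Mapping.single b d) f) -
          omega q lam \<alpha> \<beta> (Poly_Mapping.single b d) (omega q lam \<alpha> \<beta> (Poly_Mapping.single a c) f)) t" for t
      proof -
        have "poly (omega q lam \<alpha> \<beta> (block_bracket q (Poly_Mapping.single a c) (Poly_Mapping.single b d)) f) t =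
          c * d * lam powi m * lam powi n * poly f (t - of_int (m + n) * q) *
          ((of_int n * (of_nat i + q) - of_int m * (of_nat j + q)) * K (m + n) (i + j) t)"
          unfolding \<open>a = _\<close> \<open>b = _\<close> block_bracket_LL omega_left poly_add poly_smult P pw
          by (simp only: omega_basis.simps poly_0 mult_zero_left mult_zero_right add_0_right mult_ac)
        also have "\<dots> = poly (omega q lam \<alpha> \<beta> (Poly_Mapping.single a c) (omega q lam \<alpha> \<beta> (Poly_Mapping.single b d) f) -
          omega q lam \<alpha> \<beta> (Poly_Mapping.single b d) (omega q lam \<alpha> \<beta> (Poly_Mapping.single a c) f)) t"
          unfolding \<open>a = _\<close> \<open>b = _\<close> K omega_left poly_diff poly_smult P shift
          by (simp only: right_diff_distrib mult_ac)
        finally show ?thesis .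
      qed
      then show ?thesis
        by (simp add: poly_eq_poly_eq_iff[symmetric] fun_eq_iff)
    qed (simp_all add: block_bracket_C omega_left omega_right)
  next
    case (add y z)
    show ?case unfolding block_bracket_add omega_left(1) omega_right(1) add by (simp only: add_diff_add)
  qed
next
  case (add x z)
  show ?case unfolding block_bracket_add omega_left(1) omega_right(1) add by (simp only: add_diff_add)
qed

lemma lie_module_omega:
  assumes "lam \<noteq> 0"
  shows "lie_module pm_scale (block_bracket q) (block_algebra q) smult (omega q lam \<alpha> \<beta>)"
proof -
  interpret V: vector_space "smult :: complex \<Rightarrow> complex poly \<Rightarrow> complex poly"
    using module_smult by (simp add: module_iff_vector_space)
  have "Vector_Spaces.linear smult smult (omega q lam \<alpha> \<beta> x)" for x
    using V.vector_space_axioms module_smult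
    by (auto simp: Vector_Spaces.linear_def module_hom_def module_hom_axioms_def omega_right)
  then show ?thesis
    using block.subalgebra_derived_algebra[of q]
    by unfold_locales
      (auto simp: block_algebra_def omega_left omega_right omega_bracket[OF assms])
qed

end

theory Submission
  imports Defs "HOL-Computational_Algebra.Fundamental_Theorem_Algebra"
begin

text \<open>
  Identify \<open>M\<close> with \<open>\<complex>[t]\<close> so that \<open>L\<^bsub>0,0\<^esub>\<close> acts by multiplication with \<open>t\<close>. The commutator with
  \<open>L\<^bsub>0,0\<^esub>\<close> forces \<open>L\<^bsub>m,i\<^esub> f(t) = g\<^bsub>m,i\<^esub>(t) f(t - m q)\<close> with \<open>g\<^bsub>m,i\<^esub> = L\<^bsub>m,i\<^esub> 1\<close>, and the brackets become
  functional equations for the polynomials \<open>g\<^bsub>m,i\<^esub>\<close>. For \<open>i = 0\<close> the pair \<open>m = 1, n = -1\<close> makes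
  \<open>g\<^bsub>1,0\<^esub>(t) g\<^bsub>-1,0\<^esub>(t - q)\<close> a monic quadratic; leading coefficients in further brackets show that both
  factors are linear, and then all \<open>g\<^bsub>m,0\<^esub>\<close> are determined. For \<open>i > 0\<close> the \<open>L\<^bsub>0,i\<^esub>\<close> act by
  multiplication, and \<open>[L\<^bsub>0,i\<^esub>,L\<^bsub>n,i\<^esub>]\<close> expresses the squared increments of \<open>g\<^bsub>0,i\<^esub>\<close> through the
  increments of \<open>g\<^bsub>0,2i\<^esub>\<close>, which is possible only for degree at most one; the degenerate values
  \<open>i = -q/2, -q, -2q\<close> are treated separately, and only \<open>i = -q = 1\<close> leaves a free constant \<open>\<beta>\<close>.
  A submodule of \<open>\<Omega>\<close> is an ideal of \<open>\<complex>[t]\<close>; when \<open>\<alpha> \<noteq> 0\<close>, or \<open>q = -1\<close> and \<open>\<beta> \<noteq> 0\<close>, a root of its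
  generator would propagate along an arithmetic progression.
\<close>

section \<open>Increments of polynomials\<close>

lemma coeff_pcompose_shift_top:
  fixes p :: "'a::idom poly"
  assumes "degree p \<le> k"
  shows "coeff (pcompose p [:c, 1:]) k = coeff p k"
proof (cases "degree p = k")
  case True
  then show ?thesis
    using lead_coeff_comp[of "[:c, 1:]" p] by (simp add: degree_pcompose)
next
  case False
  then show ?thesis
    using assms by (simp add: coeff_eq_0 degree_pcompose)
qed

lemma degree_pcompose_shift_diff:
  fixes p :: "'a::idom poly"
  assumes "degree p \<le> Suc k"
  shows "degree (pcompose p [:c, 1:] - p) \<le> k"
  using assms by (intro degree_le) (simp add: coeff_pcompose_shift_top)

text \<open>The increment \<open>p(t + c) - p(t)\<close> begins with \<open>c p'(t)\<close>; the
  recursion on \<open>pCons\<close> replaces a binomial expansion.\<close>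

lemma coeff_pcompose_shift_diff:
  fixes p :: "'a::idom poly"
  assumes "degree p \<le> Suc k"
  shows "coeff (pcompose p [:c, 1:] - p) k = c * of_nat (Suc k) * coeff p (Suc k)"
  using assms
proof (induction p arbitrary: k)
  case 0
  then show ?case by simp
next
  case (pCons a p)
  have deg: "degree p \<le> k"
    using pCons.prems by (cases "p = 0") auto
  then have top: "coeff (pcompose p [:c, 1:]) k = coeff p k"
    by (rule coeff_pcompose_shift_top)
  show ?case
  proof (cases k)
    case 0
    then show ?thesis using top by (simp add: pcompose_pCons)
  next
    case (Suc k')
    then have "coeff (pcompose p [:c, 1:]) k' - coeff p k' = c * of_nat k * coeff p k"
      using pCons.IH[of k'] deg by simp
    then show ?thesis
      using top Suc by (simp add: pcompose_pCons algebra_simps)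
  qed
qed

lemma coeff_mult_top:
  fixes p r :: "'a::comm_semiring_0 poly"
  assumes "degree p \<le> d" "degree r \<le> e"
  shows "coeff (p * r) (d + e) = coeff p d * coeff r e"
proof -
  have "coeff (p * r) (d + e) = (\<Sum>i\<le>d + e. coeff p i * coeff r (d + e - i))"
    by (rule coeff_mult)
  also have "\<dots> = (\<Sum>i\<in>{d}. coeff p i * coeff r (d + e - i))"
  proof (intro sum.mono_neutral_right ballI)
    fix i assume "i \<in> {..d + e} - {d}"
    then have "i > d \<or> d + e - i > e" by auto
    then show "coeff p i * coeff r (d + e - i) = 0"
      using assms by (auto simp: coeff_eq_0)
  qed auto
  finally show ?thesis by simp
qed

lemma coeff_mult_pcompose_shift_diff:
  fixes p r :: "'a::idom poly"
  shows "coeff (p * (pcompose r [:c, 1:] - r)) (degree p + degree r - 1)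
    = c * of_nat (degree r) * lead_coeff p * lead_coeff r"
proof (cases "degree r")
  \<comment> \<open>With \<open>r\<close> constant the increment is zero, so the truncated
    subtraction in the index does no harm.\<close>
  case 0
  then obtain b where "r = [:b:]" by (rule degree_eq_zeroE)
  then show ?thesis by simp
next
  case (Suc k)
  then have "coeff (p * (pcompose r [:c, 1:] - r)) (degree p + k)
      = lead_coeff p * coeff (pcompose r [:c, 1:] - r) k"
    by (intro coeff_mult_top degree_pcompose_shift_diff) auto
  also have "\<dots> = c * of_nat (degree r) * lead_coeff p * lead_coeff r"
    using Suc by (simp only: coeff_pcompose_shift_diff[of r k] mult_ac)
  finally show ?thesis using Suc by simp
qed

lemma poly_eqI_pointwise:
  fixes p r :: "complex poly"
  assumes "\<And>t. poly p t = poly r t"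
  shows "p = r"
  using assms by (simp add: poly_eq_poly_eq_iff[symmetric] fun_eq_iff)

lemma poly_shift: "poly (pcompose p [:- c, 1:]) t = poly p (t - c)"
  for p :: "complex poly"
  by (simp add: poly_pcompose)

text \<open>Writing both shifts as increments cancels the product \<open>p r\<close>, so the
  commutator starts in degree \<open>degree p + degree r - 1\<close> at most. Comparing this
  coefficient yields most degree bounds below.\<close>

lemma coeff_shift_commutator:
  fixes p r s :: "complex poly"
  assumes "\<And>t. poly p t * poly r (t - x) - poly r t * poly p (t - y) = poly s t"
  shows "coeff s (degree p + degree r - 1)
    = lead_coeff p * lead_coeff r * (y * of_nat (degree p) - x * of_nat (degree r))"
proof -
  have "s = p * (pcompose r [:- x, 1:] - r) - r * (pcompose p [:- y, 1:] - p)"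
    by (rule poly_eqI_pointwise) (simp add: assms[symmetric] poly_shift algebra_simps del: poly_pCons)
  then have "coeff s (degree p + degree r - 1)
    = coeff (p * (pcompose r [:- x, 1:] - r)) (degree p + degree r - 1)
      - coeff (r * (pcompose p [:- y, 1:] - p)) (degree r + degree p - 1)"
    by (simp only: coeff_diff add.commute)
  then show ?thesis
    unfolding coeff_mult_pcompose_shift_diff by (simp add: algebra_simps)
qed

lemma degree_periodic_poly:
  fixes p :: "complex poly"
  assumes "\<And>t. poly p (t - c) = poly p t" and "c \<noteq> 0"
  shows "degree p = 0"
proof -
  \<comment> \<open>Periodicity is a vanishing commutator of \<open>p\<close> with the constant 1,
    for the shifts \<open>c\<close> and \<open>0\<close>.\<close>
  have "coeff 0 (degree [:1:: complex:] + degree p - 1) = - (c * of_nat (degree p)) * lead_coeff p"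
    using coeff_shift_commutator[of "[:1:]" p c 0 0] assms(1) by auto
  then show ?thesis using assms(2) by (cases "p = 0") auto
qed

lemma poly_eq_0_arith_progression:
  fixes p :: "complex poly"
  assumes "\<And>n. poly p (u - of_int n * q) = 0" "q \<noteq> 0"
  shows "p = 0"
proof (rule ccontr)
  assume "p \<noteq> 0"
  then have "finite {x. poly p x = 0}" by (rule poly_roots_finite)
  moreover have "range (\<lambda>n. u - of_int n * q) \<subseteq> {x. poly p x = 0}"
    using assms(1) by auto
  ultimately have "finite (range (\<lambda>n. u - of_int n * q))"
    by (rule finite_subset[rotated])
  then have "finite (UNIV :: int set)"
    by (rule finite_imageD) (use assms(2) in \<open>auto intro: injI\<close>)
  then show False by simp
qed

text \<open>
  The hypothesis extends to all increments. Writing \<open>\<phi> = a + X \<theta>\<close>, increments from \<open>0\<close> express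
  \<open>\<psi>\<close> through \<open>\<theta>\<^sup>2\<close>, and the general identity collapses to \<open>u v (\<theta> u - \<theta> v)\<^sup>2 = 0\<close>.
\<close>

lemma degree_le_1_if_square_increments:
  fixes \<phi> \<psi> :: "complex poly"
  assumes sq: "\<And>n t. (poly \<phi> t - poly \<phi> (t - of_int n * q))\<^sup>2
      = c * (of_int n * q) * (poly \<psi> t - poly \<psi> (t - of_int n * q))"
    and q: "q \<noteq> 0"
  shows "degree \<phi> \<le> 1"
proof -
  obtain a \<theta> where \<phi>: "\<phi> = pCons a \<theta>" by (cases \<phi>)
  obtain b \<chi> where \<psi>: "\<psi> = pCons b \<chi>" by (cases \<psi>)
  have all: "(u * poly \<theta> u - v * poly \<theta> v)\<^sup>2 = c * (u - v) * (u * poly \<chi> u - v * poly \<chi> v)" for u v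
  proof -
    \<comment> \<open>With \<open>u\<close> fixed, \<open>P\<close> is a polynomial in
      \<open>v\<close>; the hypothesis at \<open>t = u\<close> makes it vanish at every
      \<open>u - n q\<close>.\<close>
    define P where "P = ([:poly \<phi> u:] - \<phi>)\<^sup>2 - smult c ([:u, - 1:] * ([:poly \<psi> u:] - \<psi>))"
    have P: "poly P v = (poly \<phi> u - poly \<phi> v)\<^sup>2 - c * ((u - v) * (poly \<psi> u - poly \<psi> v))" for v
      unfolding P_def poly_diff poly_power poly_smult poly_mult by (simp add: algebra_simps)
    have "P = 0"
      using q by (rule poly_eq_0_arith_progression[rotated, where u = u]) (unfold P sq, algebra)
    then show ?thesis
      using P[of v] by (simp add: \<phi> \<psi> algebra_simps)
  qed
  have \<theta>_sq: "\<theta>\<^sup>2 = smult c \<chi>"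
  proof -
    have "[:0, 1:] * ([:0, 1:] * (\<theta>\<^sup>2 - smult c \<chi>)) = 0"
      using all[of _ 0] by (intro poly_eqI_pointwise) (simp add: power2_eq_square algebra_simps)
    then show ?thesis by simp
  qed
  have "[:0, 1:] * (\<theta> - [:poly \<theta> 1:])\<^sup>2 = 0"
  proof (rule poly_eqI_pointwise)
    fix u
    have "c * poly \<chi> v = (poly \<theta> v)\<^sup>2" for v
      using arg_cong[OF \<theta>_sq, of "\<lambda>p. poly p v"] by (simp add: poly_power)
    from this[of u] this[of 1] have "c * (u - 1) * (u * poly \<chi> u - 1 * poly \<chi> 1)
        = (u - 1) * (u * (poly \<theta> u)\<^sup>2 - (poly \<theta> 1)\<^sup>2)"
      by algebra
    then have "u * (poly \<theta> u - poly \<theta> 1)\<^sup>2 = 0"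
      using all[of u 1] by (simp add: power2_eq_square algebra_simps)
    then show "poly ([:0, 1:] * (\<theta> - [:poly \<theta> 1:])\<^sup>2) u = poly 0 u"
      by (simp add: poly_power)
  qed
  then have "\<theta> = [:poly \<theta> 1:]" by simp
  then have "degree \<theta> = 0" by (metis degree_pCons_0)
  then show ?thesis
    by (simp add: \<phi> degree_pCons_le[THEN order_trans])
qed

section \<open>The polynomials of the Witt subalgebra\<close>

text \<open>\<open>g m\<close> is the image of 1 under \<open>L m 0\<close>. The side condition
  leaves out the brackets with a central term \<open>(m^3 - m)/12\<close>, so the action of
  \<open>C\<close> does not enter.\<close>

locale witt_polys =
  fixes q :: complex and g :: "int \<Rightarrow> complex poly"
  assumes q: "q \<noteq> 0"
    and g_0: "g 0 = [:0, 1:]"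
    and rel: "m + n \<noteq> 0 \<or> \<bar>m\<bar> = 1 \<Longrightarrow>
      poly (g m) t * poly (g n) (t - of_int m * q) - poly (g n) t * poly (g m) (t - of_int n * q)
        = of_int (n - m) * q * poly (g (m + n)) t"
begin

text \<open>This symmetry carries statements about \<open>g 1\<close> to \<open>g (- 1)\<close>, and
  the formula for nonnegative indices to negative ones.\<close>

lemma flip: "witt_polys (- q) (\<lambda>m. g (- m))"
proof
  fix m n :: int and t :: complex
  assume "m + n \<noteq> 0 \<or> \<bar>m\<bar> = 1"
  then show "poly (g (- m)) t * poly (g (- n)) (t - of_int m * - q)
      - poly (g (- n)) t * poly (g (- m)) (t - of_int n * - q)
      = of_int (n - m) * - q * poly (g (- (m + n))) t"
    using rel[of "- m" "- n" t] by (auto simp: algebra_simps)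
qed (use q g_0 in auto)

lemma g_1_mult_g_minus_1:
  "\<exists>k. \<forall>t. poly (g 1) t * poly (g (- 1)) (t - q) = t\<^sup>2 - q * t + k"
proof -
  \<comment> \<open>The bracket of \<open>L 1 0\<close> and \<open>L (- 1) 0\<close> says that
    \<open>H(t) = g_1(t) g_{-1}(t - q)\<close> satisfies \<open>H(t + q) - H(t) = 2 q t\<close>. One
    solution is \<open>t^2 - q t\<close>, so the difference \<open>F\<close> has period
    \<open>q\<close>.\<close>
  define F where "F = g 1 * pcompose (g (- 1)) [:- q, 1:] - [:0, - q, 1:]"
  have F: "poly F t = poly (g 1) t * poly (g (- 1)) (t - q) - (t\<^sup>2 - q * t)" for t
    by (simp add: F_def poly_shift[of _ q, simplified] power2_eq_square algebra_simps)
  have "poly F (t - q) = poly F t" for t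
    using rel[of 1 "- 1" "t - q"] by (simp add: F g_0 power2_eq_square algebra_simps)
  then have "degree F = 0"
    using q by (rule degree_periodic_poly)
  then obtain k where "F = [:k:]" by (rule degree_eq_zeroE)
  then have "poly (g 1) t * poly (g (- 1)) (t - q) = t\<^sup>2 - q * t + k" for t
    using F[of t] by (simp add: algebra_simps)
  then show ?thesis by blast
qed

lemma degree_g_1_g_minus_1: "degree (g 1) + degree (g (- 1)) = 2"
proof -
  obtain k where k: "\<And>t. poly (g 1) t * poly (g (- 1)) (t - q) = t\<^sup>2 - q * t + k"
    using g_1_mult_g_minus_1 by blast
  have eq: "g 1 * pcompose (g (- 1)) [:- q, 1:] = [:k, - q, 1:]"
    using k by (intro poly_eqI_pointwise)
      (simp add: poly_shift[of _ q, simplified] power2_eq_square algebra_simps)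
  then have "g 1 \<noteq> 0" "pcompose (g (- 1)) [:- q, 1:] \<noteq> 0" by auto
  then show ?thesis
    using arg_cong[OF eq, of degree] by (simp add: degree_mult_eq degree_pcompose)
qed

text \<open>If \<open>g 1\<close> were constant, \<open>g (- 1)\<close> would be quadratic and its
  commutator with \<open>g 2\<close> would have degree \<open>degree (g 2) + 1\<close>, although it
  equals \<open>3 q g_1\<close>.\<close>

lemma degree_g_1_neq_0: "degree (g 1) \<noteq> 0"
proof
  assume 0: "degree (g 1) = 0"
  then have 2: "degree (g (- 1)) = 2"
    using degree_g_1_g_minus_1 by simp
  obtain k where k: "\<And>t. poly (g 1) t * poly (g (- 1)) (t - q) = t\<^sup>2 - q * t + k"
    using g_1_mult_g_minus_1 by blast
  \<comment> \<open>Otherwise evaluation at \<open>0\<close> and at \<open>- q\<close> would give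
    both \<open>k = 0\<close> and \<open>k = - 2 q^2\<close>.\<close>
  have "g 1 \<noteq> 0"
    using k[of 0] k[of "- q"] q by (auto simp: power2_eq_square)
  have rel': "poly (g (- 1)) t * poly (g 2) (t - - q) - poly (g 2) t * poly (g (- 1)) (t - 2 * q)
      = poly (smult (3 * q) (g 1)) t" for t
    using rel[of "- 1" 2 t] by simp
  have "g 2 \<noteq> 0"
  proof
    assume "g 2 = 0"
    then have "smult (3 * q) (g 1) = 0"
      using rel' by (intro poly_eqI_pointwise) auto
    then show False using q \<open>g 1 \<noteq> 0\<close> by simp
  qed
  have "coeff (smult (3 * q) (g 1)) (Suc (degree (g 2)))
      = lead_coeff (g (- 1)) * lead_coeff (g 2) * (q * (4 + of_nat (degree (g 2))))"
    using coeff_shift_commutator[OF rel'] 2 by (simp add: algebra_simps)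
  moreover have "coeff (g 1) (Suc (degree (g 2))) = 0"
    using 0 by (simp add: coeff_eq_0)
  moreover have "4 + of_nat (degree (g 2)) \<noteq> (0 :: complex)"
    using of_nat_neq_0[of "3 + degree (g 2)", where ?'a = complex] by (simp add: algebra_simps)
  ultimately have "lead_coeff (g (- 1)) * lead_coeff (g 2) * (q * (4 + of_nat (degree (g 2)))) = 0"
    by (simp only: coeff_smult mult_zero_right)
  moreover have "g (- 1) \<noteq> 0"
    using 2 by auto
  ultimately show False
    using q \<open>g 2 \<noteq> 0\<close> \<open>4 + of_nat (degree (g 2)) \<noteq> 0\<close>
    unfolding mult_eq_0_iff leading_coeff_0_iff by blast
qed

text \<open>By the flip \<open>g (- 1)\<close> is nonconstant too, so both factors are linear. The
  coefficients of \<open>t^2\<close> and \<open>t\<close> in their product express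
  \<open>g (- 1)\<close> through \<open>g 1\<close>; the constant \<open>k\<close> stays
  free.\<close>

lemma g_1_g_minus_1_form:
  obtains lam \<alpha> where "lam \<noteq> 0" "g 1 = smult lam [:- (q * \<alpha>), 1:]"
    "g (- 1) = smult (inverse lam) [:q * \<alpha>, 1:]"
proof -
  interpret flip: witt_polys "- q" "\<lambda>m. g (- m)" by (rule flip)
  have "degree (g 1) = 1" "degree (g (- 1)) = 1"
    using degree_g_1_neq_0 flip.degree_g_1_neq_0 degree_g_1_g_minus_1 by auto
  then obtain a b c d where g: "g 1 = [:b, a:]" "a \<noteq> 0" "g (- 1) = [:d, c:]" "c \<noteq> 0"
    by (metis degree1_coeffs)
  obtain k where k: "\<And>t. poly (g 1) t * poly (g (- 1)) (t - q) = t\<^sup>2 - q * t + k"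
    using g_1_mult_g_minus_1 by blast
  have "[:b, a:] * [:d - q * c, c:] = [:k, - q, 1:]"
    using k by (intro poly_eqI_pointwise) (simp add: g power2_eq_square algebra_simps)
  then have ac: "a * c = 1" and "b * c + a * (d - q * c) = - q"
    by (auto simp: algebra_simps)
  then have "b * c + a * d = 0"
    by algebra
  moreover from ac have "c = inverse a"
    by (metis inverse_unique)
  \<comment> \<open>\<open>lam\<close> is the leading coefficient of \<open>g 1\<close>, and
    \<open>q * \<alpha>\<close> is its root.\<close>
  ultimately show ?thesis
    using g q ac by (intro that[of a "- b / (a * q)"]) (auto simp: field_simps eq_neg_iff_add_eq_0)
qed

text \<open>Induction by bracketing with \<open>L 1 0\<close>. The structure constant
  \<open>(n - 1) q\<close> vanishes at \<open>n = 1\<close>, so \<open>g 2\<close> is found first,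
  from the bracket of \<open>L (- 1) 0\<close> and \<open>L 2 0\<close>.\<close>

lemma g_nonneg_form:
  assumes lam: "lam \<noteq> 0" and g_1: "g 1 = smult lam [:- (q * \<alpha>), 1:]"
    and g_minus_1: "g (- 1) = smult (inverse lam) [:q * \<alpha>, 1:]"
  shows "g (int n) = smult (lam ^ n) [:- (of_nat n * q * \<alpha>), 1:]"
proof -
  have g_2: "g 2 = smult (lam\<^sup>2) [:- (2 * q * \<alpha>), 1:]"
  proof -
    have rel': "poly (g (- 1)) t * poly (g 2) (t - - q) - poly (g 2) t * poly (g (- 1)) (t - 2 * q)
        = poly (smult (3 * q) (g 1)) t" for t
      using rel[of "- 1" 2 t] by simp
    have deg: "degree (g (- 1)) = 1"
      using lam by (simp add: g_minus_1)
    have "coeff (smult (3 * q) (g 1)) (degree (g 2))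
        = inverse lam * lead_coeff (g 2) * (q * (2 + of_nat (degree (g 2))))"
      using coeff_shift_commutator[OF rel'] deg by (simp add: g_minus_1 algebra_simps)
    moreover have "(2 + of_nat (degree (g 2)) :: complex) \<noteq> 0"
      using of_nat_neq_0[of "1 + degree (g 2)", where ?'a = complex] by (simp add: algebra_simps)
    \<comment> \<open>The commutator is nonzero in degree \<open>degree (g 2)\<close>, which
      therefore cannot exceed the degree of \<open>g 1\<close>.\<close>
    ultimately have "g 2 \<noteq> 0 \<Longrightarrow> coeff (g 1) (degree (g 2)) \<noteq> 0"
      using q lam by auto
    then have "degree (g 2) \<le> 1"
      using le_degree[of "g 1" "degree (g 2)"] lam by (cases "g 2 = 0") (auto simp: g_1)
    then obtain a b where g2: "g 2 = [:b, a:]"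
      by (metis degree1_coeffs degree_eq_zeroE le_numeral_extra(4) less_one nat_less_le pCons_0_0)
    have "smult (inverse lam) ([:q * \<alpha>, 1:] * [:b + q * a, a:] - [:b, a:] * [:q * \<alpha> - 2 * q, 1:])
        = smult (3 * q * lam) [:- (q * \<alpha>), 1:]"
      using rel' by (intro poly_eqI_pointwise) (simp add: g_1 g_minus_1 g2 algebra_simps)
    then have "inverse lam * (q * \<alpha> * (b + q * a) - b * (q * \<alpha> - 2 * q)) = - (3 * q * lam * (q * \<alpha>))"
      "inverse lam * (q * \<alpha> * a + (b + q * a) - (a * (q * \<alpha> - 2 * q) + b)) = 3 * q * lam"
      by (auto simp: algebra_simps)
    then have "q * (\<alpha> * q * a + 2 * b) = q * (- 3 * lam\<^sup>2 * q * \<alpha>)" "q * (3 * a) = q * (3 * lam\<^sup>2)"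
      using lam by (auto simp: field_simps power2_eq_square)
    then have "\<alpha> * q * a + 2 * b = - 3 * lam\<^sup>2 * q * \<alpha>" "3 * a = 3 * lam\<^sup>2"
      unfolding mult_left_cancel[OF q] .
    then have "a = lam\<^sup>2" "\<alpha> * q * a + 2 * b = - 3 * lam\<^sup>2 * q * \<alpha>"
      by simp_all
    then have "2 * b = 2 * - (2 * lam\<^sup>2 * q * \<alpha>)"
      by algebra
    then have "b = - (2 * lam\<^sup>2 * q * \<alpha>)"
      by (simp only: mult_cancel_left) simp
    then show ?thesis using \<open>a = lam\<^sup>2\<close> by (simp add: g2)
  qed
  show ?thesis
  proof (induction n)
    case 0
    then show ?case by (simp add: g_0)
  next
    case (Suc n)
    consider "n = 0" | "n = 1" | "n \<ge> 2" by linarith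
    then show ?case
    proof cases
      case 3
      have "of_int (int n - 1) * q * poly (g (1 + int n)) t
          = of_int (int n - 1) * q * poly (smult (lam ^ Suc n) [:- (of_nat (Suc n) * q * \<alpha>), 1:]) t" for t
      proof -
        have "of_int (int n - 1) * q * poly (g (1 + int n)) t
            = poly (g 1) t * poly (g (int n)) (t - q) - poly (g (int n)) t * poly (g 1) (t - of_nat n * q)"
          using rel[of 1 "int n" t] by simp
        then show ?thesis
          unfolding Suc g_1 by (simp add: algebra_simps)
      qed
      moreover have "of_int (int n - 1) * q \<noteq> 0" using 3 q by simp
      ultimately show ?thesis
        by (intro poly_eqI_pointwise) simp
    qed (use g_1 g_2 in \<open>simp_all add: numeral_2_eq_2\<close>)
  qed
qed

lemma g_form:
  obtains lam \<alpha> where "lam \<noteq> 0" "\<And>m. g m = smult (lam powi m) [:- (of_int m * q * \<alpha>), 1:]"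
proof -
  interpret flip: witt_polys "- q" "\<lambda>m. g (- m)" by (rule flip)
  obtain lam \<alpha> where g: "lam \<noteq> 0" "g 1 = smult lam [:- (q * \<alpha>), 1:]"
    "g (- 1) = smult (inverse lam) [:q * \<alpha>, 1:]"
    by (rule g_1_g_minus_1_form)
  have "g m = smult (lam powi m) [:- (of_int m * q * \<alpha>), 1:]" for m
  proof (cases m)
    case (nonneg n)
    then show ?thesis using g_nonneg_form[OF g, of n] by simp
  next
    case (neg n)
    \<comment> \<open>The flip replaces \<open>q\<close> by \<open>- q\<close> and
      \<open>lam\<close> by its inverse, and keeps \<alpha>.\<close>
    then show ?thesis
      using flip.g_nonneg_form[of "inverse lam" \<alpha> "Suc n"] g
      by (simp add: power_int_minus power_inverse del: of_nat_Suc power_Suc minus_add_distrib)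
  qed
  with g(1) show ?thesis by (rule that)
qed

end

section \<open>The polynomials of the Block type Lie algebra\<close>

definition block_index :: "complex \<Rightarrow> int \<Rightarrow> nat \<Rightarrow> bool" where
  "block_index q m i \<longleftrightarrow> \<not> (m = 0 \<and> of_nat i = - 2 * q)"

text \<open>\<open>G m i\<close> stands for \<open>L m i\<close> applied to 1 and \<open>Z\<close>
  for \<open>C\<close> applied to 1. The omitted index can occur only on the right, and there with
  structure constant zero.\<close>

locale block_polys =
  fixes q :: complex and G :: "int \<Rightarrow> nat \<Rightarrow> complex poly" and Z :: "complex poly"
  assumes q: "q \<noteq> 0"
    and G_0_0: "G 0 0 = [:0, 1:]"
    and rel: "block_index q m i \<Longrightarrow> block_index q n j \<Longrightarrow>
      poly (G m i) t * poly (G n j) (t - of_int m * q) - poly (G n j) t * poly (G m i) (t - of_int n * q)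
      = (of_int n * (of_nat i + q) - of_int m * (of_nat j + q)) * poly (G (m + n) (i + j)) t
        + (if m + n = 0 \<and> i + j = 0 then (of_int m ^ 3 - of_int m) / 12 else 0) * poly Z t"
begin

lemma block_index_0 [simp]: "block_index q m 0"
  using q by (simp add: block_index_def)

lemma witt_polys: "witt_polys q (\<lambda>m. G m 0)"
proof
  fix m n :: int and t
  assume *: "m + n \<noteq> 0 \<or> \<bar>m\<bar> = 1"
  then have "(if m + n = 0 \<and> 0 + 0 = (0::nat) then (of_int m ^ 3 - of_int m) / 12 else 0) = (0::complex)"
    by (cases "m = 1"; cases "m = - 1") auto
  then show "poly (G m 0) t * poly (G n 0) (t - of_int m * q)
      - poly (G n 0) t * poly (G m 0) (t - of_int n * q)
      = of_int (n - m) * q * poly (G (m + n) 0) t"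
    unfolding rel[OF block_index_0 block_index_0] by (simp add: algebra_simps)
qed (use q G_0_0 in auto)

text \<open>The bracket is graded by the first index, so scaling degree \<open>m\<close> by
  \<open>lam powi - m\<close> respects it; central terms sit in degree 0 and leave \<open>Z\<close>
  unscaled.\<close>

lemma rescale:
  assumes lam: "lam \<noteq> 0"
  shows "block_polys q (\<lambda>m i. smult (lam powi - m) (G m i)) Z"
proof
  fix m n :: int and i j t
  assume "block_index q m i" "block_index q n j"
  note r = arg_cong[OF rel[OF this, of t], of "(*) (lam powi - (m + n))"]
  have pw: "lam powi (- m) * lam powi (- n) = lam powi (- (m + n))"
    using lam by (simp add: power_int_add[symmetric])
  have "poly (smult (lam powi - m) (G m i)) t * poly (smult (lam powi - n) (G n j)) (t - of_int m * q)
      - poly (smult (lam powi - n) (G n j)) t * poly (smult (lam powi - m) (G m i)) (t - of_int n * q)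
      = lam powi (- (m + n)) * (poly (G m i) t * poly (G n j) (t - of_int m * q)
        - poly (G n j) t * poly (G m i) (t - of_int n * q))"
    unfolding pw[symmetric] by (simp add: algebra_simps)
  also note r
  finally show "poly (smult (lam powi - m) (G m i)) t * poly (smult (lam powi - n) (G n j)) (t - of_int m * q)
      - poly (smult (lam powi - n) (G n j)) t * poly (smult (lam powi - m) (G m i)) (t - of_int n * q)
      = (of_int n * (of_nat i + q) - of_int m * (of_nat j + q))
          * poly (smult (lam powi - (m + n)) (G (m + n) (i + j))) t
        + (if m + n = 0 \<and> i + j = 0 then (of_int m ^ 3 - of_int m) / 12 else 0) * poly Z t"
    by (cases "m + n = 0") (simp_all only: distrib_left poly_smult mult.left_commute if_False
        simp_thms mult_zero_left mult_zero_right minus_zero power_int_0_right mult_1)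
qed (use q G_0_0 in auto)

end

text \<open>The normalization \<open>\<lambda> = 1\<close>, reached by rescaling.\<close>

locale normalized_block_polys = block_polys +
  fixes \<alpha> :: complex
  assumes G_m_0: "G m 0 = [:- (of_int m * q * \<alpha>), 1:]"
begin

text \<open>The bracket of \<open>L 2 0\<close> and \<open>L (- 2) 0\<close> contains
  \<open>C / 2\<close>, while the linear \<open>G m 0\<close> satisfy the centreless relation by
  themselves.\<close>

lemma Z_eq_0: "Z = 0"
proof (rule poly_eqI_pointwise)
  fix t
  show "poly Z t = poly 0 t"
    using rel[of 2 0 "- 2" 0 t] by (simp add: G_m_0 algebra_simps)
qed

lemma bracket_L_m_0:
  assumes "block_index q n j" "j > 0"
  shows "(t - of_int m * q * \<alpha>) * poly (G n j) (t - of_int m * q)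
    - poly (G n j) t * (t - of_int n * q - of_int m * q * \<alpha>)
    = (of_int n * q - of_int m * (of_nat j + q)) * poly (G (m + n) j) t"
  using rel[of m 0 n j t] assms by (simp add: G_m_0 algebra_simps)

text \<open>\<open>L 0 i\<close> acts without a shift, so bracketing with it amounts to
  multiplication by an increment of \<open>G 0 i\<close>.\<close>

lemma bracket_L_0_i:
  assumes "block_index q 0 i" "block_index q n j"
  shows "(poly (G 0 i) t - poly (G 0 i) (t - of_int n * q)) * poly (G n j) t
    = of_int n * (of_nat i + q) * poly (G n (i + j)) t"
  using rel[of 0 i n j t] assms by (simp add: algebra_simps)

lemma G_n_i_via_G_0_i:
  assumes "block_index q 0 i"
  shows "of_int n * (of_nat i + q) * poly (G n i) t
    = (t - of_int n * q * \<alpha>) * (poly (G 0 i) t - poly (G 0 i) (t - of_int n * q))"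
  using bracket_L_0_i[OF assms, of n 0 t] by (simp add: G_m_0 mult.commute)

text \<open>Zero increments of \<open>G 0 i\<close> kill \<open>G n i\<close> for
  \<open>n \<noteq> 0\<close>, as \<open>i + q\<close> is nonzero. The bracket of
  \<open>L 1 0\<close> with \<open>L (- 1) i\<close>, of structure constant
  \<open>- (i + 2 q)\<close>, then kills \<open>G 0 i\<close>.\<close>

lemma G_n_i_eq_0_if_G_0_i_const:
  assumes i: "i > 0" "of_nat i \<noteq> - q" "of_nat i \<noteq> - 2 * q" and const: "degree (G 0 i) = 0"
  shows "G n i = 0"
proof -
  have iq: "of_nat i + q \<noteq> 0"
    using i(2) by (simp add: eq_neg_iff_add_eq_0)
  have idx: "block_index q m i" for m
    using i(3) by (simp add: block_index_def)
  have nonzero: "G m i = 0" if "m \<noteq> 0" for m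
  proof (rule poly_eqI_pointwise)
    fix t
    obtain b where "G 0 i = [:b:]" using const by (rule degree_eq_zeroE)
    then show "poly (G m i) t = poly 0 t"
      using G_n_i_via_G_0_i[OF idx, of m t] that iq by simp
  qed
  have "G 0 i = 0"
  proof (rule poly_eqI_pointwise)
    fix t
    have "of_nat i + 2 * q \<noteq> 0"
      using i(3) by (simp add: eq_neg_iff_add_eq_0)
    moreover have "(of_nat i + 2 * q) * poly (G 0 i) t = 0"
      using bracket_L_m_0[OF idx i(1), where n = "- 1" and m = 1 and t = t]
      by (simp add: nonzero algebra_simps)
    ultimately show "poly (G 0 i) t = poly 0 t" by simp
  qed
  with nonzero show ?thesis by metis
qed

text \<open>
  The first step bounds the degree of \<open>G 0 i\<close> by one. The linear case is then excluded by
  \<open>[L\<^bsub>1,0\<^esub>, L\<^bsub>1,i\<^esub>]\<close>, since \<open>G 1 i\<close> is proportional to \<open>G 1 0\<close> while the structure constant is \<open>-i\<close>.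
\<close>

lemma G_n_i_eq_0_generic:
  assumes i: "i > 0" "of_nat i \<noteq> - q" "of_nat i \<noteq> - 2 * q" "2 * of_nat i \<noteq> - q"
  shows "G n i = 0"
proof (rule G_n_i_eq_0_if_G_0_i_const[OF i(1-3)])
  let ?\<phi> = "G 0 i" and ?\<psi> = "G 0 (i + i)"
  \<comment> \<open>The value \<open>i = - q / 2\<close> is excluded because \<open>2 i + q\<close>
    becomes a denominator, and \<open>i = - q\<close> because there \<open>i + q = 0\<close> and the
    index \<open>(0, 2 i)\<close> is omitted.\<close>
  have iq: "of_nat i + q \<noteq> 0" and iiq: "of_nat (i + i) + q \<noteq> 0"
    using i(2,4) by (simp_all add: eq_neg_iff_add_eq_0)
  have idx: "block_index q m i" "block_index q m (i + i)" for m
    using i(2,3) by (auto simp: block_index_def mult_2[symmetric] simp del: mult_minus_right)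
  have "(poly ?\<phi> t - poly ?\<phi> (t - of_int n * q))\<^sup>2
      = (of_nat i + q)\<^sup>2 / (q * (of_nat (i + i) + q)) * (of_int n * q)
        * (poly ?\<psi> t - poly ?\<psi> (t - of_int n * q))" for n t
  proof -
    define \<Delta>\<phi> where "\<Delta>\<phi> = ?\<phi> - pcompose ?\<phi> [:- (of_int n * q), 1:]"
    define \<Delta>\<psi> where "\<Delta>\<psi> = ?\<psi> - pcompose ?\<psi> [:- (of_int n * q), 1:]"
    have \<Delta>: "poly \<Delta>\<phi> t = poly ?\<phi> t - poly ?\<phi> (t - of_int n * q)"
      "poly \<Delta>\<psi> t = poly ?\<psi> t - poly ?\<psi> (t - of_int n * q)" for t
      unfolding \<Delta>\<phi>_def \<Delta>\<psi>_def by (simp_all only: poly_diff poly_shift)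
    have lin: "poly [:- (of_int n * q * \<alpha>), 1:] t = t - of_int n * q * \<alpha>" for t
      by simp
    \<comment> \<open>The brackets of \<open>L 0 i\<close> with \<open>L n i\<close> and
      \<open>L n 0\<close>, and of \<open>L 0 (i + i)\<close> with \<open>L n 0\<close>, allow
      elimination of \<open>G n i\<close> and \<open>G n (i + i)\<close>. The common factor
      \<open>t - n q \<alpha>\<close> has a root, so it is cancelled between polynomials and not
      pointwise.\<close>
    have "[:- (of_int n * q * \<alpha>), 1:] * (smult (of_nat (i + i) + q) (\<Delta>\<phi>\<^sup>2))
        = [:- (of_int n * q * \<alpha>), 1:] * smult (of_int n * (of_nat i + q)\<^sup>2) \<Delta>\<psi>"
    proof (rule poly_eqI_pointwise)
      fix t
      have "poly \<Delta>\<phi> t * poly (G n i) t = of_int n * (of_nat i + q) * poly (G n (i + i)) t"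
        "of_int n * (of_nat i + q) * poly (G n i) t = (t - of_int n * q * \<alpha>) * poly \<Delta>\<phi> t"
        "of_int n * (of_nat (i + i) + q) * poly (G n (i + i)) t = (t - of_int n * q * \<alpha>) * poly \<Delta>\<psi> t"
        unfolding \<Delta> by (intro bracket_L_0_i G_n_i_via_G_0_i idx)+
      then have "(t - of_int n * q * \<alpha>) * ((of_nat (i + i) + q) * (poly \<Delta>\<phi> t)\<^sup>2)
          = (t - of_int n * q * \<alpha>) * (of_int n * (of_nat i + q)\<^sup>2 * poly \<Delta>\<psi> t)"
        by algebra
      then show "poly ([:- (of_int n * q * \<alpha>), 1:] * smult (of_nat (i + i) + q) (\<Delta>\<phi>\<^sup>2)) t
          = poly ([:- (of_int n * q * \<alpha>), 1:] * smult (of_int n * (of_nat i + q)\<^sup>2) \<Delta>\<psi>) t"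
        by (simp only: poly_mult poly_smult poly_power lin)
    qed
    then have "smult (of_nat (i + i) + q) (\<Delta>\<phi>\<^sup>2) = smult (of_int n * (of_nat i + q)\<^sup>2) \<Delta>\<psi>"
      by (subst (asm) mult_left_cancel) auto
    then have "(of_nat (i + i) + q) * (poly \<Delta>\<phi> t)\<^sup>2 = of_int n * (of_nat i + q)\<^sup>2 * poly \<Delta>\<psi> t"
      by (metis poly_smult poly_power)
    moreover have "X = b / (q * a) * (x * q) * y" if "a * X = x * b * y" "a \<noteq> 0" for a b x y X :: complex
      using that q by (simp add: field_simps)
    ultimately show ?thesis
      using iiq unfolding \<Delta> by blast
  qed
  then have "degree ?\<phi> \<le> 1"
    using q by (rule degree_le_1_if_square_increments)
  then obtain a b where \<phi>: "?\<phi> = [:b, a:]"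
    by (metis degree1_coeffs degree_eq_zeroE less_one nat_less_le pCons_0_0)
  have G: "(of_nat i + q) * poly (G n i) t = (t - of_int n * q * \<alpha>) * (a * q)" if "n \<noteq> 0" for n t
  proof -
    have "of_int n * ((of_nat i + q) * poly (G n i) t) = of_int n * ((t - of_int n * q * \<alpha>) * (a * q))"
      using G_n_i_via_G_0_i[OF idx(1), of n t] by (simp add: \<phi> algebra_simps)
    then show ?thesis using that by simp
  qed
  \<comment> \<open>At this point the factor \<open>t - 2 q \<alpha>\<close> equals 1, so
    \<open>(i + q) G_{2,i}\<close> takes the value \<open>a q\<close>.\<close>
  define t where "t = 2 * q * \<alpha> + 1"
  have "(of_nat i + q) * (of_nat i * poly (G 2 i) t) = 0"
    using arg_cong[OF bracket_L_m_0[OF idx(1) i(1), where n = 1 and m = 1 and t = t],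
        of "(*) (of_nat i + q)"] G[of 1 t] G[of 1 "t - q"]
    by (simp del: mult_eq_0_iff) algebra
  then have "a * q = 0"
    using G[of 2 t] iq i(1) by (simp add: t_def)
  then show "degree ?\<phi> = 0"
    using q by (simp add: \<phi>)
qed

lemma G_n_i_eq_0:
  assumes i: "i > 0" "of_nat i \<noteq> - q" and "block_index q n i"
  shows "G n i = 0"
proof (cases "of_nat i = - 2 * q")
  case False
  show ?thesis
  proof (cases "2 * of_nat i = - q")
    case True
    \<comment> \<open>The generic case applies to \<open>3i\<close>, so that the cube of the increment of \<open>G 0 i\<close> vanishes.\<close>
    have q_eq: "q = - 2 * of_nat i"
      using True by (metis minus_minus mult_minus_left)
    have nz: "of_nat i \<noteq> (0 :: complex)" using i(1) by simp
    have eqs: "of_nat (i + i) \<noteq> - 2 * q" "of_nat (i + i + i) \<noteq> - q" "of_nat (i + i + i) \<noteq> - 2 * q"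
      "2 * of_nat (i + i + i) \<noteq> - q"
      unfolding q_eq of_nat_add by (use nz in algebra)+
    have idx: "block_index q m i" "block_index q m (i + i)" for m
      using False eqs(1) by (auto simp: block_index_def)
    have zero: "G 1 (i + (i + i)) = 0"
      using i(1) eqs by (intro G_n_i_eq_0_generic) (auto simp: add.assoc)
    define \<Delta>\<phi> where "\<Delta>\<phi> = G 0 i - pcompose (G 0 i) [:- q, 1:]"
    have \<Delta>: "poly \<Delta>\<phi> t = poly (G 0 i) t - poly (G 0 i) (t - of_int 1 * q)" for t
      unfolding \<Delta>\<phi>_def by (simp only: poly_diff poly_shift of_int_1 mult_1)
    have "[:- (q * \<alpha>), 1:] * \<Delta>\<phi> ^ 3 = 0"
    proof (rule poly_eqI_pointwise)
      fix t
      have "poly \<Delta>\<phi> t * poly (G 1 (i + i)) t = of_int 1 * (of_nat i + q) * poly (G 1 (i + (i + i))) t"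
        "poly \<Delta>\<phi> t * poly (G 1 i) t = of_int 1 * (of_nat i + q) * poly (G 1 (i + i)) t"
        "of_int 1 * (of_nat i + q) * poly (G 1 i) t = (t - of_int 1 * q * \<alpha>) * poly \<Delta>\<phi> t"
        unfolding \<Delta> by (intro bracket_L_0_i G_n_i_via_G_0_i idx)+
      then have "(t - q * \<alpha>) * poly \<Delta>\<phi> t ^ 3 = 0"
        unfolding zero of_int_1 mult_1 poly_0 by algebra
      then show "poly ([:- (q * \<alpha>), 1:] * \<Delta>\<phi> ^ 3) t = poly 0 t"
        by (auto simp: poly_power)
    qed
    then have "\<Delta>\<phi> = 0"
      unfolding mult_eq_0_iff by simp
    then have "poly (G 0 i) (t - q) = poly (G 0 i) t" for t
      using \<Delta>[of t] by simp
    then have "degree (G 0 i) = 0"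
      using q by (rule degree_periodic_poly)
    then show ?thesis
      using i False by (intro G_n_i_eq_0_if_G_0_i_const)
  qed (use G_n_i_eq_0_generic i False in blast)
next
  case True
  then have n: "n \<noteq> 0" using assms(3) by (simp add: block_index_def)
  \<comment> \<open>Here \<open>(0, i)\<close> is omitted. The bracket of \<open>L (- n) 0\<close>
    with \<open>L n i\<close> has structure constant zero, whereas its top coefficient is a nonzero
    multiple of the leading coefficient of \<open>G n i\<close>.\<close>
  have "poly [:of_int n * q * \<alpha>, 1:] t * poly (G n i) (t - - (of_int n * q))
      - poly (G n i) t * poly [:of_int n * q * \<alpha>, 1:] (t - of_int n * q) = poly 0 t" for t
    using bracket_L_m_0[OF assms(3) i(1), of t "- n"] True by (simp add: algebra_simps)
  from coeff_shift_commutator[OF this]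
  have "lead_coeff (G n i) * (of_int n * q * of_nat (Suc (degree (G n i)))) = 0"
    by (simp add: algebra_simps del: leading_coeff_0_iff mult_eq_0_iff)
  then show ?thesis
    using n q by (simp del: of_nat_Suc)
qed

text \<open>As \<open>i + q = 0\<close>, \<open>L 0 i\<close> commutes with all
  \<open>L n 0\<close>, so \<open>G 0 i\<close> is periodic and hence constant. The bracket of
  \<open>L (- n) 0\<close> with \<open>L n i\<close> is \<open>n q\<close> times
  \<open>L 0 i\<close> and carries this constant to every \<open>n\<close>.\<close>

lemma G_n_i_const:
  assumes i: "of_nat i = - q"
  shows "G n i = [:coeff (G 0 i) 0:]"
proof -
  have i0: "i > 0" using q i by (cases i) auto
  have idx: "block_index q m i" for m
    using q i by (simp add: block_index_def)
  have "poly (G 0 i) (t - q) = poly (G 0 i) t" for t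
  proof -
    have "[:- (q * \<alpha>), 1:] * (G 0 i - pcompose (G 0 i) [:- q, 1:]) = 0"
    proof (rule poly_eqI_pointwise)
      fix t
      show "poly ([:- (q * \<alpha>), 1:] * (G 0 i - pcompose (G 0 i) [:- q, 1:])) t = poly 0 t"
        unfolding poly_mult poly_diff poly_shift
        using G_n_i_via_G_0_i[OF idx, of 1 t] i by simp
    qed
    then have "G 0 i - pcompose (G 0 i) [:- q, 1:] = 0"
      unfolding mult_eq_0_iff by simp
    from arg_cong[OF this, of "\<lambda>p. poly p t"] show ?thesis
      unfolding poly_diff poly_shift by simp
  qed
  then have "degree (G 0 i) = 0"
    using q by (rule degree_periodic_poly)
  then obtain \<beta> where \<beta>: "G 0 i = [:\<beta>:]" by (rule degree_eq_zeroE)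
  show ?thesis
  proof (cases "n = 0")
    case False
    have rel': "poly [:of_int n * q * \<alpha>, 1:] t * poly (G n i) (t - - (of_int n * q))
        - poly (G n i) t * poly [:of_int n * q * \<alpha>, 1:] (t - of_int n * q)
        = poly [:of_int n * q * \<beta>:] t" for t
      using bracket_L_m_0[OF idx i0, of t "- n" n] i by (simp add: \<beta> algebra_simps)
    from coeff_shift_commutator[OF this]
    have lead: "coeff [:of_int n * q * \<beta>:] (degree (G n i))
        = of_int n * q * of_nat (Suc (degree (G n i))) * lead_coeff (G n i)"
      by (simp add: algebra_simps del: leading_coeff_0_iff mult_eq_0_iff)
    have "degree (G n i) = 0"
    proof (rule ccontr)
      assume "degree (G n i) \<noteq> 0"
      then have "coeff [:of_int n * q * \<beta>:] (degree (G n i)) = 0" by (simp add: coeff_eq_0)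
      then have "G n i = 0" using lead False q by (simp del: of_nat_Suc)
      then show False using \<open>degree (G n i) \<noteq> 0\<close> by simp
    qed
    then obtain b where b: "G n i = [:b:]" by (rule degree_eq_zeroE)
    show ?thesis using lead False q by (simp add: b \<beta>)
  qed (simp add: \<beta>)
qed

lemma G_form:
  obtains \<beta> where "\<And>m i. block_index q m i \<Longrightarrow>
    G m i = (if i = 0 then [:- (of_int m * q * \<alpha>), 1:] else 0) + (if q = - 1 \<and> i = 1 then [:\<beta>:] else 0)"
\<comment> \<open>For \<open>q = - 1\<close> the polynomial \<open>G 0 1\<close> is constant, and
  its value is \<beta>.\<close>
proof (rule that[of "coeff (G 0 1) 0"])
  fix m i assume idx: "block_index q m i"
  consider "i = 0" | "i > 0" "of_nat i \<noteq> - q" | "i = 1" "of_nat i = - q" | "i > 1" "of_nat i = - q"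
    by linarith
  then show "G m i = (if i = 0 then [:- (of_int m * q * \<alpha>), 1:] else 0)
    + (if q = - 1 \<and> i = 1 then [:coeff (G 0 1) 0:] else 0)"
  proof cases
    case 2
    then show ?thesis using G_n_i_eq_0[OF 2 idx] by auto
  next
    case 3
    moreover from this have "q = - 1" by (metis minus_minus of_nat_1)
    ultimately show ?thesis using G_n_i_const[of i m] by simp
  next
    case 4
    \<comment> \<open>For \<open>- q = i > 1\<close>, \<open>L 1 i\<close> is exactly the bracket of
      \<open>L 1 1\<close> with \<open>L 0 (i - 1)\<close>, and \<open>L 1 1\<close> acts as zero;
      hence the constant vanishes.\<close>
    have q_eq: "q = - of_nat i" using 4(2) by simp
    have "G 1 1 = 0"
      using 4(1) by (intro G_n_i_eq_0) (auto simp: q_eq block_index_def)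
    moreover have "block_index q 0 (i - 1)"
    proof -
      have "i - 1 \<noteq> 2 * i" using 4(1) by simp
      then have "of_nat (i - 1) \<noteq> (of_nat (2 * i) :: complex)" by (metis of_nat_eq_iff)
      moreover have "- 2 * q = of_nat (2 * i)" by (simp add: q_eq)
      ultimately show ?thesis unfolding block_index_def by metis
    qed
    moreover have "block_index q 1 1" by (simp add: block_index_def)
    ultimately have "poly (G 1 i) t = 0" for t
      using rel[of 1 1 0 "i - 1" t] 4(1) by (simp add: q_eq of_nat_diff)
    then have "G 1 i = 0" by (intro poly_eqI_pointwise) simp
    then have "coeff (G 0 i) 0 = 0" using G_n_i_const[OF 4(2), of 1] by simp
    then show ?thesis using G_n_i_const[OF 4(2), of m] 4(1) by simp
  qed (simp add: G_m_0)
qed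

end

lemma (in block_polys) G_form:
  obtains lam \<alpha> \<beta> where "lam \<noteq> 0" "Z = 0" "\<And>m i. block_index q m i \<Longrightarrow> G m i =
    smult (lam powi m) ((if i = 0 then [:- (of_int m * q * \<alpha>), 1:] else 0)
      + (if q = - 1 \<and> i = 1 then [:\<beta>:] else 0))"
proof -
  interpret witt_polys q "\<lambda>m. G m 0" by (rule witt_polys)
  obtain lam \<alpha> where lam: "lam \<noteq> 0" and G_m_0: "\<And>m. G m 0 = smult (lam powi m) [:- (of_int m * q * \<alpha>), 1:]"
    by (rule g_form) blast
  interpret normalized_block_polys q "\<lambda>m i. smult (lam powi - m) (G m i)" Z \<alpha>
  proof -
    interpret block_polys q "\<lambda>m i. smult (lam powi - m) (G m i)" Z
      using lam by (rule rescale)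
    show "normalized_block_polys q (\<lambda>m i. smult (lam powi - m) (G m i)) Z \<alpha>"
      by unfold_locales (use lam in \<open>simp add: G_m_0 power_int_minus\<close>)
  qed
  obtain \<beta> where \<beta>: "\<And>m i. block_index q m i \<Longrightarrow> smult (lam powi - m) (G m i)
      = (if i = 0 then [:- (of_int m * q * \<alpha>), 1:] else 0) + (if q = - 1 \<and> i = 1 then [:\<beta>:] else 0)"
    by (rule G_form) blast
  show ?thesis
  proof (rule that[OF lam Z_eq_0])
    fix m i assume "block_index q m i"
    from \<beta>[OF this, symmetric] show "G m i = smult (lam powi m)
        ((if i = 0 then [:- (of_int m * q * \<alpha>), 1:] else 0) + (if q = - 1 \<and> i = 1 then [:\<beta>:] else 0))"
      using lam by (simp only: smult_smult power_int_minus) simp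
  qed
qed

section \<open>Modules over the Block type Lie algebra\<close>

lemma single_in_block_algebra:
  assumes "q \<noteq> 0"
  shows "Poly_Mapping.single (L m i) c \<in> block_algebra q \<longleftrightarrow> block_index q m i \<or> c = 0"
    and "Poly_Mapping.single C c \<in> block_algebra q"
  by (auto simp: block_algebra_eq[OF assms] block_index_def lookup_single when_def)

locale poly_block_module =
  lie_module pm_scale "block_bracket q" "block_algebra q" smult act
  for q and act :: "block \<Rightarrow> complex poly \<Rightarrow> complex poly" +
  assumes q: "q \<noteq> 0"
    and act_L_0_0: "act (Poly_Mapping.single (L 0 0) 1) p = [:0, 1:] * p"
begin

abbreviation "act_basis k \<equiv> act (Poly_Mapping.single k 1)"

text \<open>
  The junk value \<open>0\<close> at the omitted index \<open>(0, -2q)\<close> is harmless: that index only occurs in brackets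
  with a vanishing structure constant.
\<close>

definition coefficient :: "int \<Rightarrow> nat \<Rightarrow> complex poly" where
  "coefficient m i = (if block_index q m i then act_basis (L m i) 1 else 0)"

lemmas single_in = single_in_block_algebra[OF q]

lemma act_add_right: "x \<in> block_algebra q \<Longrightarrow> act x (v + w) = act x v + act x w"
  and act_smult_right: "x \<in> block_algebra q \<Longrightarrow> act x (smult c v) = smult c (act x v)"
  using act_linear[of x] by (auto simp: Vector_Spaces.linear_iff)

lemma act_single:
  assumes "Poly_Mapping.single k 1 \<in> block_algebra q"
  shows "act (Poly_Mapping.single k c) v = smult c (act_basis k v)"
  using act_scale[OF assms, of c v] by simp

lemma act_0: "act 0 v = 0"
  using act_single[OF single_in(2), of 0 v] by simp

lemma act_single_L:
  "Poly_Mapping.single (L m i) c \<in> block_algebra q \<Longrightarrow>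
    act (Poly_Mapping.single (L m i) c) 1 = smult c (coefficient m i)"
  using act_single[of "L m i" c 1] by (auto simp: act_0 single_in coefficient_def)

text \<open>An operator \<open>A\<close> with \<open>A t = (t - c) A\<close> is determined by the
  image of 1.\<close>

lemma act_basis_eq_mult:
  assumes k: "Poly_Mapping.single k 1 \<in> block_algebra q"
    and comm: "\<And>p. act_basis k ([:0, 1:] * p) = [:- c, 1:] * act_basis k p"
  shows "act_basis k p = act_basis k 1 * pcompose p [:- c, 1:]"
proof (induction p)
  case 0
  then show ?case using act_smult_right[OF k, of 0 0] by simp
next
  case (pCons a p)
  have "act_basis k (pCons a p) = act_basis k (smult a 1 + [:0, 1:] * p)"
    by simp
  also have "\<dots> = smult a (act_basis k 1) + [:- c, 1:] * act_basis k p"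
    by (simp only: act_add_right[OF k] act_smult_right[OF k] comm)
  finally show ?case
    by (simp only: pCons.IH) (simp add: pcompose_pCons algebra_simps)
qed

lemma act_basis_L:
  assumes idx: "block_index q m i"
  shows "act_basis (L m i) p = coefficient m i * pcompose p [:- (of_int m * q), 1:]"
proof -
  have in_alg: "Poly_Mapping.single (L m i) 1 \<in> block_algebra q"
    "Poly_Mapping.single (L 0 0) 1 \<in> block_algebra q"
    using idx q by (simp_all add: single_in block_index_def)
  \<comment> \<open>The bracket of \<open>L 0 0\<close> with \<open>L m i\<close> is
    \<open>m q\<close> times \<open>L m i\<close>.\<close>
  have "act_basis (L m i) ([:0, 1:] * p) = [:- (of_int m * q), 1:] * act_basis (L m i) p" for p
    using act_bracket[OF in_alg(2,1), of p] act_single[OF in_alg(1), of "of_int m * q" p]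
    by (simp add: block_bracket_LL act_L_0_0 algebra_simps cong: if_cong)
  with in_alg(1) have "act_basis (L m i) p = act_basis (L m i) 1 * pcompose p [:- (of_int m * q), 1:]"
    by (rule act_basis_eq_mult)
  then show ?thesis
    using idx by (simp add: coefficient_def)
qed

lemma act_basis_C: "act_basis C p = act_basis C 1 * p"
proof -
  have in_alg: "Poly_Mapping.single (L 0 0) 1 \<in> block_algebra q"
    using q by (simp add: single_in block_index_def)
  have "act_basis C ([:0, 1:] * p) = [:- 0, 1:] * act_basis C p" for p
    using act_bracket[OF in_alg single_in(2), of 1 p] by (simp add: block_bracket_C act_0 act_L_0_0)
  with single_in(2) have "act_basis C p = act_basis C 1 * pcompose p [:- 0, 1:]"
    by (rule act_basis_eq_mult)
  then show ?thesis by (simp add: pcompose_idR)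
qed

sublocale block_polys q coefficient "act_basis C 1"
proof
  show "coefficient 0 0 = [:0, 1:]"
    using q by (simp add: coefficient_def block_index_def act_L_0_0)
next
  fix m n :: int and i j :: nat and t :: complex
  assume idx: "block_index q m i" "block_index q n j"
  define c where "c = of_int n * (of_nat i + q) - of_int m * (of_nat j + q)"
  define d where "d = (if m + n = 0 \<and> i + j = 0 then (of_int m ^ 3 - of_int m) / 12 else (0::complex))"
  have in_alg: "Poly_Mapping.single (L m i) 1 \<in> block_algebra q"
    "Poly_Mapping.single (L n j) 1 \<in> block_algebra q"
    using idx by (simp_all add: single_in)
  have bracket: "block_bracket q (Poly_Mapping.single (L m i) 1) (Poly_Mapping.single (L n j) 1)
      = Poly_Mapping.single (L (m + n) (i + j)) c + Poly_Mapping.single C d"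
    by (simp only: block_bracket_LL c_def d_def mult_1)
  have "c = 0" if "m + n = 0" "of_nat (i + j) = - 2 * q"
  proof -
    have "of_int n = - (of_int m :: complex)"
      using that(1) by (metis add.commute add_eq_0_iff of_int_minus)
    then have "c = - of_int m * (of_nat (i + j) + 2 * q)"
      by (simp add: c_def algebra_simps)
    then show ?thesis unfolding that(2) by simp
  qed
  then have in_alg': "Poly_Mapping.single (L (m + n) (i + j)) c \<in> block_algebra q"
    unfolding single_in block_index_def by blast
  have "smult c (coefficient (m + n) (i + j)) + smult d (act_basis C 1)
      = coefficient m i * pcompose (coefficient n j) [:- (of_int m * q), 1:]
        - coefficient n j * pcompose (coefficient m i) [:- (of_int n * q), 1:]"
    using act_bracket[OF in_alg, of 1] in_alg'
    unfolding bracket act_add[OF in_alg' single_in(2)] act_single_L[OF in_alg']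
      act_single[OF single_in(2), of d] act_basis_L[OF idx(1)] act_basis_L[OF idx(2)]
    by (simp add: pcompose_1)
  from arg_cong[OF this, of "\<lambda>p. poly p t"]
  show "poly (coefficient m i) t * poly (coefficient n j) (t - of_int m * q)
      - poly (coefficient n j) t * poly (coefficient m i) (t - of_int n * q)
      = (of_int n * (of_nat i + q) - of_int m * (of_nat j + q)) * poly (coefficient (m + n) (i + j)) t
        + (if m + n = 0 \<and> i + j = 0 then (of_int m ^ 3 - of_int m) / 12 else 0) * poly (act_basis C 1) t"
    unfolding poly_diff poly_add poly_mult poly_smult poly_shift c_def[symmetric] d_def[symmetric] by simp
qed (rule q)

lemma act_eq_lin_ext:
  assumes x: "x \<in> block_algebra q"
  shows "act x v = lin_ext smult (\<lambda>k. act_basis k v) x"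
proof -
  have in_alg: "Poly_Mapping.single k c \<in> block_algebra q" if "k \<in> Poly_Mapping.keys x" for k c
  proof (cases k)
    case (L m i)
    then have "block_index q m i"
      using x that by (auto simp: block_algebra_eq[OF q] block_index_def in_keys_iff)
    then show ?thesis by (simp add: L single_in)
  qed (simp add: single_in)
  \<comment> \<open>Additivity of \<open>act\<close> is available only on
    \<open>block_algebra q\<close>, so membership of the partial sums is carried through the
    induction.\<close>
  have *: "(\<Sum>k\<in>A. Poly_Mapping.single k (Poly_Mapping.lookup x k)) \<in> block_algebra q \<and>
      act (\<Sum>k\<in>A. Poly_Mapping.single k (Poly_Mapping.lookup x k)) v
        = (\<Sum>k\<in>A. smult (Poly_Mapping.lookup x k) (act_basis k v))"
    if "finite A" "A \<subseteq> Poly_Mapping.keys x" for A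
    using that
  proof (induction A)
    case empty
    then show ?case using single_in(2)[of 0] by (simp add: act_0)
  next
    case (insert k A)
    then have "Poly_Mapping.single k (Poly_Mapping.lookup x k) \<in> block_algebra q"
      "act (Poly_Mapping.single k (Poly_Mapping.lookup x k)) v
        = smult (Poly_Mapping.lookup x k) (act_basis k v)"
      by (auto intro: in_alg act_single)
    with insert show ?case
      using subspace_add[of "block_algebra q"] subalgebra by (simp add: act_add subalgebra_def)
  qed
  have sum_eq: "(\<Sum>k\<in>Poly_Mapping.keys x. Poly_Mapping.single k (Poly_Mapping.lookup x k)) = x"
    by (rule poly_mapping_eqI) (simp add: lookup_sum lookup_single when_def in_keys_iff)
  show ?thesis
    using *[OF finite_keys order_refl] unfolding lin_ext_def sum_eq by (rule conjunct2)
qed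

lemma act_eq_omega:
  obtains lam \<alpha> \<beta> where "lam \<noteq> 0" "\<And>x v. x \<in> block_algebra q \<Longrightarrow> act x v = omega q lam \<alpha> \<beta> x v"
proof -
  obtain lam \<alpha> \<beta> where lam: "lam \<noteq> 0" and act_C: "act_basis C 1 = 0"
    and coefficient: "\<And>m i. block_index q m i \<Longrightarrow> coefficient m i =
      smult (lam powi m) ((if i = 0 then [:- (of_int m * q * \<alpha>), 1:] else 0)
        + (if q = - 1 \<and> i = 1 then [:\<beta>:] else 0))"
    by (rule G_form) blast
  have "act x v = omega q lam \<alpha> \<beta> x v" if x: "x \<in> block_algebra q" for x v
    unfolding act_eq_lin_ext[OF x] omega_def lin_ext_def
  proof (rule sum.cong[OF refl])
    fix k assume k: "k \<in> Poly_Mapping.keys x"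
    show "smult (Poly_Mapping.lookup x k) (act_basis k v)
        = smult (Poly_Mapping.lookup x k) (omega_basis q lam \<alpha> \<beta> k v)"
    proof (cases k)
      case (L m i)
      then have "block_index q m i"
        using x k by (auto simp: block_algebra_eq[OF q] block_index_def in_keys_iff)
      then show ?thesis
        unfolding L omega_basis.simps by (simp only: act_basis_L coefficient mult_smult_left)
    next
      case C
      then show ?thesis using act_basis_C[of v] act_C by simp
    qed
  qed
  with lam show ?thesis by (rule that)
qed

end

section \<open>Transport of free modules of rank one to polynomials\<close>

lemma (in lie_module) lie_module_transfer:
  assumes f: "Vector_Spaces.linear scaleW scaleV f" and bij: "bij f"
  shows "lie_module scaleG bracket \<gg> scaleW (\<lambda>x w. inv f (act x (f w)))"
proof -
  interpret f: Vector_Spaces.linear scaleW scaleV f by fact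
  interpret inv: Vector_Spaces.linear scaleV scaleW "inv f"
    using bij_module_hom_imp_inv_module_hom[OF f.module_hom_axioms bij]
    by (simp add: module_hom_iff_linear)
  have f_inv: "f (inv f v) = v" for v
    using bij by (simp add: bij_is_surj surj_f_inv_f)
  show ?thesis
  proof (intro lie_module.intro lie_module_axioms.intro)
    fix x assume "x \<in> \<gg>"
    then have "Vector_Spaces.linear scaleV scaleV (act x)" by (rule act_linear)
    then show "Vector_Spaces.linear scaleW scaleW (\<lambda>w. inv f (act x (f w)))"
      by (auto simp: Vector_Spaces.linear_iff f.add f.scale inv.add inv.scale f.vs1.vector_space_axioms)
  next
    fix x y and w assume "x \<in> \<gg>" "y \<in> \<gg>"
    then show "inv f (act (x + y) (f w)) = inv f (act x (f w)) + inv f (act y (f w))"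
      "inv f (act (bracket x y) (f w))
        = inv f (act x (f (inv f (act y (f w))))) - inv f (act y (f (inv f (act x (f w)))))"
      by (simp_all only: act_add act_bracket inv.add inv.diff f_inv)
  next
    fix c x and w assume "x \<in> \<gg>"
    then show "inv f (act (scaleG c x) (f w)) = scaleW c (inv f (act x (f w)))"
      by (simp only: act_scale inv.scale)
  qed (rule lie_algebra_axioms f.vs1.vector_space_axioms subalgebra)+
qed

lemma free_of_rank_1_imp_bij:
  assumes "module scl" "free_of_rank 1 scl"
  obtains v where "bij (\<lambda>p. scl p v)"
proof -
  interpret module scl by fact
  obtain v where v: "independent {v}" "span {v} = UNIV"
    using assms(2) by (auto simp: free_of_rank_def card_1_singleton_iff)
  have "inj (\<lambda>p. scl p v)"
  proof (rule injI)
    fix p r assume "scl p v = scl r v"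
    then have "scl (p - r) v = 0" by (simp add: scale_left_diff_distrib)
    then show "p = r"
      using v(1) by (auto simp: dependent_finite dest: spec[of _ "\<lambda>_. p - r"])
  qed
  with v(2) show ?thesis
    by (intro that) (simp add: bij_def span_singleton)
qed

text \<open>For a free generator \<open>v\<close>, the map sending \<open>p\<close> to
  \<open>p(L_{0,0}) v\<close> is a linear bijection from polynomials to the module. Conjugation by
  it turns \<open>L 0 0\<close> into multiplication by \<open>t\<close>.\<close>

lemma block_module_isomorphic_omega:
  fixes scaleV :: "complex \<Rightarrow> 'v::ab_group_add \<Rightarrow> 'v"
  assumes q: "q \<noteq> 0"
    and "lie_module pm_scale (block_bracket q) (block_algebra q) scaleV act"
    and free: "free_of_rank 1 (poly_act scaleV (act (Poly_Mapping.single (L 0 0) 1)))"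
  obtains lam \<alpha> \<beta> where "lam \<noteq> 0"
    "isomorphic_modules (block_algebra q) scaleV act smult (omega q lam \<alpha> \<beta>)"
proof -
  interpret lie_module pm_scale "block_bracket q" "block_algebra q" scaleV act by fact
  let ?T = "act (Poly_Mapping.single (L 0 0) 1)"
  have "Poly_Mapping.single (L 0 0) 1 \<in> block_algebra q"
    using q by (simp add: single_in_block_algebra block_index_def)
  then have T: "Vector_Spaces.linear scaleV scaleV ?T" by (rule act_linear)
  interpret P: module "poly_act scaleV ?T"
    using T by (rule module_poly_act)
  obtain v where bij: "bij (\<lambda>p. poly_act scaleV ?T p v)"
    using P.module_axioms free by (rule free_of_rank_1_imp_bij)
  define f where "f = (\<lambda>p. poly_act scaleV ?T p v)"
  have const: "poly_act scaleV ?T [:c:] w = scaleV c w" for c w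
    by (simp add: poly_act_def)
  have X: "poly_act scaleV ?T [:0, 1:] w = ?T w" for w
    by (simp add: poly_act_def)
  have f_add: "f (p + r) = f p + f r" for p r
    by (simp only: f_def P.scale_left_distrib)
  have f_smult: "f (smult c p) = scaleV c (f p)" for c p
  proof -
    have "f (smult c p) = poly_act scaleV ?T ([:c:] * p) v"
      by (simp add: f_def)
    also have "\<dots> = scaleV c (f p)"
      by (simp only: P.scale_scale[symmetric] const f_def)
    finally show ?thesis .
  qed
  have f_X: "f ([:0, 1:] * p) = ?T (f p)" for p
    by (simp only: P.scale_scale[symmetric] X f_def)
  have bij_f: "bij f" using bij by (simp add: f_def)
  have "vector_space (smult :: complex \<Rightarrow> complex poly \<Rightarrow> complex poly)"
    using module_smult by (simp add: module_iff_vector_space)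
  then have lin_f: "Vector_Spaces.linear smult scaleV f"
    unfolding Vector_Spaces.linear_iff by (simp add: f_smult f_add V.vector_space_axioms)
  have inv_f: "inv f (f p) = p" for p
    using bij_f by (simp add: bij_is_inj)
  interpret A: poly_block_module q "\<lambda>x p. inv f (act x (f p))"
  proof (intro poly_block_module.intro poly_block_module_axioms.intro)
    show "inv f (?T (f p)) = [:0, 1:] * p" for p
      by (simp only: f_X[symmetric] inv_f)
  qed (rule lie_module_transfer[OF lin_f bij_f], rule q)
  obtain lam \<alpha> \<beta> where lam: "lam \<noteq> 0"
    and omega: "\<And>x p. x \<in> block_algebra q \<Longrightarrow> inv f (act x (f p)) = omega q lam \<alpha> \<beta> x p"
    by (rule A.act_eq_omega) blast
  have "f (inv f w) = w" for w
    using bij_f by (simp add: bij_is_surj surj_f_inv_f)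
  then have "inv f (act x w) = omega q lam \<alpha> \<beta> x (inv f w)" if "x \<in> block_algebra q" for x w
    using omega[OF that, of "inv f w"] by simp
  moreover have "Vector_Spaces.linear scaleV smult (inv f)"
    using bij_module_hom_imp_inv_module_hom[of smult scaleV f] lin_f bij_f
    by (simp add: module_hom_iff_linear)
  ultimately show ?thesis
    using bij_f by (intro that[OF lam]) (auto simp: isomorphic_modules_def intro: bij_imp_bij_inv)
qed

section \<open>Simplicity and its invariance under isomorphism\<close>

lemma isomorphic_modules_sym:
  assumes "isomorphic_modules \<gg> scaleV actV scaleW actW"
  shows "isomorphic_modules \<gg> scaleW actW scaleV actV"
proof -
  obtain f where f: "Vector_Spaces.linear scaleV scaleW f" "bij f"
    and act: "\<And>x v. x \<in> \<gg> \<Longrightarrow> f (actV x v) = actW x (f v)"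
    using assms unfolding isomorphic_modules_def by blast
  have "Vector_Spaces.linear scaleW scaleV (inv f)"
    using bij_module_hom_imp_inv_module_hom[of scaleV scaleW f] f by (simp add: module_hom_iff_linear)
  moreover have "inv f (actW x w) = actV x (inv f w)" if "x \<in> \<gg>" for x w
    using act[OF that, of "inv f w"] f(2)
    by (metis bij_inv_eq_iff)
  ultimately show ?thesis
    unfolding isomorphic_modules_def using bij_imp_bij_inv[OF f(2)] by blast
qed

lemma simple_module_if_isomorphic:
  fixes scaleV :: "complex \<Rightarrow> 'v::ab_group_add \<Rightarrow> 'v" and scaleW :: "complex \<Rightarrow> 'w::ab_group_add \<Rightarrow> 'w"
  assumes "isomorphic_modules \<gg> scaleV actV scaleW actW" and simple: "simple_module \<gg> scaleV actV"
  shows "simple_module \<gg> scaleW actW"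
proof -
  obtain f where f: "Vector_Spaces.linear scaleV scaleW f" "bij f"
    and act: "\<And>x v. x \<in> \<gg> \<Longrightarrow> f (actV x v) = actW x (f v)"
    using assms(1) unfolding isomorphic_modules_def by blast
  interpret f: Vector_Spaces.linear scaleV scaleW f by (rule f(1))
  show ?thesis
    unfolding simple_module_def
  proof (intro conjI allI impI)
    obtain v :: 'v where "v \<noteq> 0"
      using simple by (auto simp: simple_module_def)
    then have "f v \<noteq> 0" using f(2) by (metis f.zero bij_def inj_eq)
    then show "(UNIV :: 'w set) \<noteq> {0}" by blast
  next
    fix N assume N: "submodule \<gg> scaleW actW N"
    then have "submodule \<gg> scaleV actV (f -` N)"
      using f.subspace_vimage[of N] by (simp add: submodule_def act)
    then have "f -` N = {0} \<or> f -` N = UNIV"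
      using simple by (simp add: simple_module_def)
    moreover have "f ` (f -` N) = N"
      using f(2) by (simp add: bij_is_surj)
    ultimately show "N = {0} \<or> N = UNIV"
      using f(2) by (metis bij_is_surj f.zero image_empty image_insert)
  qed
qed

lemma simple_module_cong_isomorphic:
  assumes "isomorphic_modules \<gg> scaleV actV scaleW actW"
  shows "simple_module \<gg> scaleV actV \<longleftrightarrow> simple_module \<gg> scaleW actW"
  using simple_module_if_isomorphic[OF assms]
    simple_module_if_isomorphic[OF isomorphic_modules_sym[OF assms]] by (rule iffI)

lemma simple_omega:
  assumes q: "q \<noteq> 0" and lam: "lam \<noteq> 0" and nz: "\<alpha> \<noteq> 0 \<or> q = - 1 \<and> \<beta> \<noteq> 0"
  shows "simple_module (block_algebra q) smult (omega q lam \<alpha> \<beta>)"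
  unfolding simple_module_def
proof (intro conjI allI impI)
  show "(UNIV :: complex poly set) \<noteq> {0}"
    using one_neq_zero by blast
next
  fix N assume N: "submodule (block_algebra q) smult (omega q lam \<alpha> \<beta>) N"
  interpret V: module "smult :: complex \<Rightarrow> complex poly \<Rightarrow> complex poly" by (rule module_smult)
  have sub: "V.subspace N" using N by (simp add: submodule_def)
  have basis: "omega_basis q lam \<alpha> \<beta> (L m i) p \<in> N" if "p \<in> N" "block_index q m i" for p m i
  proof -
    have "omega q lam \<alpha> \<beta> (Poly_Mapping.single (L m i) 1) p \<in> N"
      using N that q by (simp add: submodule_def single_in_block_algebra)
    then show ?thesis by (simp add: omega_left)
  qed
  have X: "[:0, 1:] * p \<in> N" if "p \<in> N" for p
    using basis[OF that, of 0 0] q by (simp add: block_index_def)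
  have ideal: "r * p \<in> N" if "p \<in> N" for p r
    using that
  proof (induction r arbitrary: p)
    case 0
    then show ?case using V.subspace_0[OF sub] by simp
  next
    case (pCons c r)
    have "smult c p + r * ([:0, 1:] * p) \<in> N"
      using pCons by (intro V.subspace_add[OF sub] V.subspace_scale[OF sub] pCons.IH X)
    then show ?case by (simp add: algebra_simps)
  qed
  show "N = {0} \<or> N = UNIV"
  proof (rule disjCI)
    assume "N \<noteq> UNIV"
    show "N = {0}"
    proof (rule ccontr)
      assume "N \<noteq> {0}"
      then obtain f0 where "f0 \<in> N \<and> f0 \<noteq> 0"
        using V.subspace_0[OF sub] by blast
      then obtain f where f: "f \<in> N" "f \<noteq> 0" and min: "\<And>p. p \<in> N \<Longrightarrow> p \<noteq> 0 \<Longrightarrow> degree f \<le> degree p"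
        using ex_has_least_nat[of "\<lambda>p. p \<in> N \<and> p \<noteq> 0" f0 degree] by blast
      have dvd: "f dvd p" if "p \<in> N" for p
      proof -
        have "p mod f \<in> N"
          using V.subspace_diff[OF sub that ideal[OF f(1), of "p div f"]] by (simp add: minus_div_mult_eq_mod)
        then have "p mod f = 0"
          using min degree_mod_less[OF f(2), of p] by (meson leD)
        then show ?thesis by (simp add: dvd_eq_mod_eq_0)
      qed
      have "\<not> constant (poly f)"
      proof
        assume "constant (poly f)"
        then have "degree f = 0" by (simp add: constant_degree)
        then obtain c where c: "f = [:c:]" by (rule degree_eq_zeroE)
        have "p \<in> N" for p
          using ideal[OF f(1), of "smult (inverse c) p"] f(2) by (simp add: c)
        then show False using \<open>N \<noteq> UNIV\<close> by blast
      qed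
      then obtain r where r: "poly f r = 0"
        using fundamental_theorem_of_algebra by blast
      have root: "poly (omega_basis q lam \<alpha> \<beta> (L m i) f) r = 0" if idx: "block_index q m i" for m i
      proof -
        obtain h where "omega_basis q lam \<alpha> \<beta> (L m i) f = f * h"
          using dvd[OF basis[OF f(1) idx]] by (rule dvdE)
        then show ?thesis by (simp only: poly_mult r mult_zero_left)
      qed
      show False
        using nz
      proof
        assume \<alpha>: "\<alpha> \<noteq> 0"
        \<comment> \<open>\<open>L m 0\<close> sends \<open>f\<close> to a polynomial with root
          \<open>r\<close>, so \<open>f\<close> vanishes at \<open>r - m q\<close> unless
          \<open>r = m q \<alpha>\<close>. The linear factor has the value
          \<open>r - m q \<alpha>\<close> there and absorbs this exception.\<close>
        have "poly (f * [:r - r * \<alpha>, \<alpha>:]) (r - of_int m * q) = 0" for m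
        proof -
          have "(r - of_int m * q * \<alpha>) * poly f (r - of_int m * q) = 0"
            using root[of m 0] q lam
            by (simp add: poly_omega_basis block_index_def del: omega_basis.simps)
          then show ?thesis by (simp only: poly_mult mult.commute) (simp add: algebra_simps)
        qed
        then have "f * [:r - r * \<alpha>, \<alpha>:] = 0"
          using q by (rule poly_eq_0_arith_progression)
        then show False using f(2) \<alpha> unfolding mult_eq_0_iff by simp
      next
        assume \<beta>: "q = - 1 \<and> \<beta> \<noteq> 0"
        \<comment> \<open>\<open>L m 1\<close> acts as a nonzero multiple of the shift, so no
          \<open>m\<close> is exceptional.\<close>
        have "poly f (r - of_int m * q) = 0" for m
          using root[of m 1] \<beta> lam
          by (auto simp: poly_omega_basis block_index_def simp del: omega_basis.simps)
        then have "f = 0"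
          using q by (rule poly_eq_0_arith_progression)
        then show False using f(2) by simp
      qed
    qed
  qed
qed

text \<open>Each basis element acts as zero or as a scalar multiple of a shift followed by
  multiplication by \<open>t\<close>, so the ideal generated by \<open>t\<close> is a proper nonzero
  submodule.\<close>

lemma not_simple_omega:
  assumes "\<not> (q = - 1 \<and> \<beta> \<noteq> 0)"
  shows "\<not> simple_module (block_algebra q) smult (omega q lam 0 \<beta>)"
proof
  assume simple: "simple_module (block_algebra q) smult (omega q lam 0 \<beta>)"
  interpret V: module "smult :: complex \<Rightarrow> complex poly \<Rightarrow> complex poly" by (rule module_smult)
  let ?N = "{p :: complex poly. poly p 0 = 0}"
  have "poly (omega_basis q lam 0 \<beta> k p) 0 = 0" for k p
    using assms by (cases k) (auto simp: poly_omega_basis simp del: omega_basis.simps(1))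
  then have "submodule (block_algebra q) smult (omega q lam 0 \<beta>) ?N"
    by (auto simp: submodule_def omega_def lin_ext_def poly_sum intro!: V.subspaceI)
  then have "?N = {0} \<or> ?N = UNIV"
    using simple by (simp add: simple_module_def)
  moreover have "[:0, 1:] \<in> ?N" "1 \<notin> ?N" "[:0, 1:] \<notin> {0 :: complex poly}"
    by auto
  ultimately show False by blast
qed

text \<open>One family \<open>omega\<close> serves both cases, since \<beta> enters it only for
  \<open>q = - 1\<close>. The criterion for simplicity covers every presentation of the module in
  this form, not only the one constructed.\<close>

theorem theorem3p1:
  fixes q :: complex
    and scaleV :: "complex \<Rightarrow> 'v::ab_group_add \<Rightarrow> 'v"
    and act :: "block \<Rightarrow> 'v \<Rightarrow> 'v"
  assumes "q \<noteq> 0"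
    and "lie_module pm_scale (block_bracket q) (block_algebra q) scaleV act"
    and "free_of_rank 1 (poly_act scaleV (act (Poly_Mapping.single (L 0 0) 1)))"
  shows "(\<exists>lam \<alpha> \<beta>. lam \<noteq> 0 \<and>
            isomorphic_modules (block_algebra q) scaleV act smult (omega q lam \<alpha> \<beta>)) \<and>
         (\<forall>lam \<alpha> \<beta>. lam \<noteq> 0 \<longrightarrow>
            isomorphic_modules (block_algebra q) scaleV act smult (omega q lam \<alpha> \<beta>) \<longrightarrow>
            (q \<noteq> - 1 \<longrightarrow> (simple_module (block_algebra q) scaleV act \<longleftrightarrow> \<alpha> \<noteq> 0)) \<and>
            (q = - 1 \<longrightarrow> (simple_module (block_algebra q) scaleV act \<longleftrightarrow> \<alpha> \<noteq> 0 \<or> \<beta> \<noteq> 0)))"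
proof (intro conjI allI)
  show "\<exists>lam \<alpha> \<beta>. lam \<noteq> 0 \<and>
      isomorphic_modules (block_algebra q) scaleV act smult (omega q lam \<alpha> \<beta>)"
    using block_module_isomorphic_omega[OF assms] by blast
next
  fix lam \<alpha> \<beta>
  have "simple_module (block_algebra q) scaleV act \<longleftrightarrow> \<alpha> \<noteq> 0 \<or> q = - 1 \<and> \<beta> \<noteq> 0"
    if "lam \<noteq> 0" "isomorphic_modules (block_algebra q) scaleV act smult (omega q lam \<alpha> \<beta>)"
    unfolding simple_module_cong_isomorphic[OF that(2)]
    using simple_omega[OF assms(1) that(1)] not_simple_omega by blast
  then show "lam \<noteq> 0 \<longrightarrow>
      isomorphic_modules (block_algebra q) scaleV act smult (omega q lam \<alpha> \<beta>) \<longrightarrow>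
      (q \<noteq> - 1 \<longrightarrow> (simple_module (block_algebra q) scaleV act \<longleftrightarrow> \<alpha> \<noteq> 0)) \<and>
      (q = - 1 \<longrightarrow> (simple_module (block_algebra q) scaleV act \<longleftrightarrow> \<alpha> \<noteq> 0 \<or> \<beta> \<noteq> 0))"
    by blast
qed

end
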